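(* There are Salem numbers of every trace: for every integer $m \in \mathbb{Z}$ there is a Salem number whose trace is $m$.
   Context: A Salem number is a real algebraic integer greater than $1$ whose other conjugates over $\mathbb{Q}$ all lie in the closed disc $|z|\leq 1$, with at least one conjugate on $|z|=1$. The trace of an algebraic integer is the sum of the zeros of its minimal polynomial over $\mathbb{Q}$. *)

theory Defs
  imports
    "HOL-Computational_Algebra.Computational_Algebra"
    "HOL-Computational_Algebra.Field_as_Ring"
begin

abbreviation rat_to_complex_poly :: "rat poly \<Rightarrow> complex poly" where
  "rat_to_complex_poly \<equiv> map_poly of_rat"

definition is_min_poly :: "complex \<Rightarrow> rat poly \<Rightarrow> bool" where
  "is_min_poly x p \<longleftrightarrow>
     lead_coeff p = 1 \<and> irreducible p \<and> poly (rat_to_complex_poly p) x = 0"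

(* Only meaningful for algebraic x; see min_poly_ex1 below. *)
definition min_poly :: "complex \<Rightarrow> rat poly" where
  "min_poly x = (THE p. is_min_poly x p)"

definition conjugates :: "complex \<Rightarrow> complex set" where
  "conjugates x = {z. poly (rat_to_complex_poly (min_poly x)) z = 0}"

definition alg_trace :: "complex \<Rightarrow> complex" where
  "alg_trace x = sum_mset (proots (rat_to_complex_poly (min_poly x)))"

definition salem_number :: "real \<Rightarrow> bool" where
  "salem_number \<tau> \<longleftrightarrow>
     algebraic_int \<tau> \<and> \<tau> > 1 \<and>
     (\<forall>z \<in> conjugates (of_real \<tau>) - {of_real \<tau>}. norm z \<le> 1) \<and>
     (\<exists>z \<in> conjugates (of_real \<tau>) - {of_real \<tau>}. norm z = 1)"

lemma rat_to_complex_poly_add: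
  "rat_to_complex_poly (p + q) = rat_to_complex_poly p + rat_to_complex_poly q"
  by (rule poly_eqI) (simp add: coeff_map_poly of_rat_add)

lemma rat_to_complex_poly_mult:
  "rat_to_complex_poly (p * q) = rat_to_complex_poly p * rat_to_complex_poly q"
  by (rule poly_eqI) (simp add: coeff_map_poly coeff_mult of_rat_sum of_rat_mult)

lemma is_min_poly_unique:
  assumes "is_min_poly x p" "is_min_poly x q"
  shows "p = q"
proof -
  have dvd: "p dvd q" if p: "is_min_poly x p" and q: "is_min_poly x q" for p q
  proof (rule ccontr)
    assume "\<not> p dvd q"
    moreover have "prime_elem p"
      using p field_poly_irreducible_imp_prime by (auto simp: is_min_poly_def)
    ultimately have "coprime p q" by (intro prime_elem_imp_coprime)
    then obtain u v where "u * p + v * q = 1"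
      by (metis bezout_coefficients_fst_snd coprime_iff_gcd_eq_1)
    then have "poly (rat_to_complex_poly (u * p + v * q)) x = poly (rat_to_complex_poly 1) x"
      by simp
    with p q show False
      by (simp add: is_min_poly_def rat_to_complex_poly_add rat_to_complex_poly_mult)
  qed
  have monic: "lead_coeff p = 1" "lead_coeff q = 1"
    using assms by (simp_all add: is_min_poly_def)
  then have nz: "p \<noteq> 0" "q \<noteq> 0" by auto
  have "degree p = degree q"
    using dvd[OF assms] dvd[OF assms(2,1)] nz by (metis dvd_imp_degree_le le_antisym)
  moreover obtain r where r: "q = p * r" using dvd[OF assms] by (rule dvdE)
  ultimately have "degree r = 0" using nz by (auto simp: degree_mult_eq)
  then obtain a where a: "r = [:a:]" by (rule degree_eq_zeroE)
  have "lead_coeff r = 1" using monic r by (simp add: lead_coeff_mult)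
  with a r show ?thesis by simp
qed

lemma is_min_poly_exists:
  assumes "algebraic x"
  shows "\<exists>p. is_min_poly x p"
proof -
  let ?P = "\<lambda>p::rat poly. p \<noteq> 0 \<and> poly (rat_to_complex_poly p) x = 0"
  obtain c where c: "\<And>i. coeff c i \<in> \<int>" "c \<noteq> 0" "poly c x = 0"
    using assms unfolding algebraic_def by auto
  have "\<forall>i. \<exists>r::rat. coeff c i = of_rat r"
    using c(1) by (metis Ints_cases of_rat_of_int_eq)
  define d where "d = map_poly (\<lambda>z. if z = 0 then 0 else SOME r::rat. z = of_rat r) c"
  have dc: "rat_to_complex_poly d = c"
  proof (rule poly_eqI)
    fix i
    obtain r :: rat where "coeff c i = of_rat r"
      using \<open>\<forall>i. \<exists>r::rat. coeff c i = of_rat r\<close> by blast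
    then have "coeff c i = of_rat (SOME r::rat. coeff c i = of_rat r)" by (rule someI)
    then show "coeff (rat_to_complex_poly d) i = coeff c i"
      by (auto simp: d_def coeff_map_poly)
  qed
  then have "?P d" using c by auto
  then obtain q where q: "?P q" and least: "\<And>r. ?P r \<Longrightarrow> degree q \<le> degree r"
    using ex_has_least_nat[of ?P d degree] by auto
  define p where "p = smult (inverse (lead_coeff q)) q"
  have p: "p \<noteq> 0" "degree p = degree q" "lead_coeff p = 1" using q by (auto simp: p_def)
  have "p = [:inverse (lead_coeff q):] * q" by (simp add: p_def)
  then have root: "poly (rat_to_complex_poly p) x = 0"
    using q by (simp only: rat_to_complex_poly_mult) simp
  have deg: "degree p \<noteq> 0"
  proof
    assume "degree p = 0"
    then obtain a where "p = [:a:]" by (rule degree_eq_zeroE)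
    with root p(1) show False by (simp add: map_poly_pCons)
  qed
  have "irreducible p"
  proof (rule irreducibleI)
    show "p \<noteq> 0" by fact
    show "\<not> p dvd 1" using deg p(1) by (simp add: is_unit_iff_degree)
  next
    fix a b assume ab: "p = a * b"
    then have nz: "a \<noteq> 0" "b \<noteq> 0" using p(1) by auto
    have d: "degree p = degree a + degree b" using ab nz by (simp add: degree_mult_eq)
    from root ab have "?P a \<or> ?P b" using nz by (simp add: rat_to_complex_poly_mult)
    then have "degree p \<le> degree a \<or> degree p \<le> degree b" using least p(2) by auto
    then have "degree a = 0 \<or> degree b = 0" using d by auto
    then show "a dvd 1 \<or> b dvd 1" using nz by (auto simp: is_unit_iff_degree)
  qed
  with p root show ?thesis unfolding is_min_poly_def by blast
qed

theorem min_poly_ex1: "algebraic x \<Longrightarrow> \<exists>!p. is_min_poly x p"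
  using is_min_poly_exists is_min_poly_unique by blast

corollary is_min_poly_min_poly: "algebraic x \<Longrightarrow> is_min_poly x (min_poly x)"
  unfolding min_poly_def by (rule theI') (rule min_poly_ex1)

end

theory Submission
  imports Defs "HOL-Number_Theory.Cong"
begin

text \<open>
  Let \<open>e\<^sub>0 = 2\<close>, \<open>e\<^sub>k\<^sub>+\<^sub>1 = 1 + (2 e\<^sub>k)!\<close>, let \<open>Q\<close> be the product of \<open>z - \<zeta>\<close> over all \<open>e\<^sub>i\<close>-th roots of unity
  \<open>\<zeta>\<close> with \<open>i < r\<close>, and, for \<open>c > 0\<close> with \<open>c + r\<close> even, let \<open>P\<close> be \<open>z Q(z)\<close> times
  \<open>z - 1/z - (c A(z) + A(z^e\<^sub>0) + \<dots> + A(z^e\<^sub>r\<^sub>-\<^sub>1)) / 2\<close>, where \<open>A(w) = (w + 1) / (w - 1)\<close>.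
  This is a monic integer polynomial of trace \<open>1 + (c - r) / 2\<close>. On the unit circle \<open>A\<close> is a cotangent,
  so between any two neighbouring zeros of \<open>Q\<close> there is a zero of \<open>P\<close>; the signs of \<open>P\<close> at \<open>0\<close>, \<open>1\<close>, \<open>\<infinity>\<close>
  supply the two missing zeros, one in \<open>(0, 1)\<close> and one in \<open>(1, \<infinity>)\<close>.

  A nontrivial factorisation of \<open>P\<close> would split off a factor with all zeros on the circle
  (if its zeros included the one in \<open>(0, 1)\<close> but not the one in \<open>(1, \<infinity>)\<close>, its constant term would lie
  strictly between \<open>0\<close> and \<open>1\<close> in modulus). By Kronecker's theorem its zeros are roots of unity, and
  with one of order \<open>n\<close> also the conjugate \<open>cis (2 \<pi> / n)\<close> is a zero of \<open>P\<close>.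
  If \<open>n\<close> divides some \<open>e\<^sub>i\<close>, this is a simple pole of the bracket and so not a zero of \<open>P\<close>. Otherwise, at the
  angle \<open>2 \<pi> / n\<close>, the cotangents have nonnegative sum and \<open>sin (2 \<pi> / n) > 0\<close>, thanks to the congruences
  \<open>e\<^sub>i \<equiv> 1 (mod n)\<close> for all \<open>i\<close> beyond the first index \<open>j\<close> with \<open>n < 2 e\<^sub>j\<close>.
\<close>

section \<open>Integer polynomials with all zeros on the unit circle\<close>

abbreviation ipoly :: "int poly \<Rightarrow> 'a::comm_ring_1 poly" where
  "ipoly \<equiv> map_poly of_int"

lemma ipoly_add: "ipoly (p + q) = ipoly p + ipoly q"
  by (rule poly_eqI) (simp add: coeff_map_poly)

lemma ipoly_diff: "ipoly (p - q) = ipoly p - ipoly q"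
  by (rule poly_eqI) (simp add: coeff_map_poly)

lemma ipoly_mult: "ipoly (p * q) = ipoly p * ipoly q"
  by (rule poly_eqI) (simp add: coeff_map_poly coeff_mult)

lemma ipoly_power: "ipoly (p ^ n) = ipoly p ^ n"
  by (induction n) (simp_all add: ipoly_mult)

lemma ipoly_sum: "ipoly (sum f A) = (\<Sum>a\<in>A. ipoly (f a))"
  by (induction A rule: infinite_finite_induct) (simp_all add: ipoly_add)

lemma ipoly_prod: "ipoly (prod f A) = (\<Prod>a\<in>A. ipoly (f a))"
  by (induction A rule: infinite_finite_induct) (simp_all add: ipoly_mult)

lemma degree_ipoly: "degree (ipoly p :: 'a::{comm_ring_1,ring_char_0} poly) = degree p"
  by (simp add: degree_map_poly)

lemma lead_coeff_ipoly:
  "lead_coeff (ipoly p :: 'a::{comm_ring_1,ring_char_0} poly) = of_int (lead_coeff p)"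
  by (simp add: degree_ipoly coeff_map_poly)

lemma poly_ipoly_of_int: "poly (ipoly p) (of_int x) = of_int (poly p x)"
  by (induction p) (simp_all add: map_poly_pCons)

lemma poly_ipoly_pcompose_monom:
  "poly (ipoly (pcompose p (monom 1 n))) (x :: 'a::comm_ring_1) = poly (ipoly p) (x ^ n)"
  by (induction p) (simp_all add: pcompose_pCons ipoly_add ipoly_mult map_poly_pCons
      map_poly_monom poly_monom)

lemma norm_poly_ipoly_le:
  assumes "norm (z :: complex) \<le> 1"
  shows "norm (poly (ipoly p) z) \<le> (\<Sum>i\<le>degree p. \<bar>real_of_int (coeff p i)\<bar>)"
proof -
  have "poly (ipoly p) z = (\<Sum>i\<le>degree p. of_int (coeff p i) * z ^ i)"
    by (simp add: poly_altdef degree_ipoly coeff_map_poly)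
  also have "norm \<dots> \<le> (\<Sum>i\<le>degree p. norm (of_int (coeff p i) * z ^ i))"
    by (rule norm_sum)
  also have "\<dots> \<le> (\<Sum>i\<le>degree p. \<bar>real_of_int (coeff p i)\<bar>)"
    using assms by (intro sum_mono) (simp add: norm_mult norm_power mult_left_le power_le_one)
  finally show ?thesis .
qed

section \<open>Frobenius congruences modulo a prime\<close>

text \<open>All inner binomial coefficients are divisible by \<open>l\<close>. The ring is arbitrary
  because the congruence serves both integers and integer polynomials.\<close>

lemma prime_dvd_add_power_diff:
  fixes a b :: "'a::comm_ring_1"
  assumes "prime l"
  shows "of_nat l dvd (a + b) ^ l - (a ^ l + b ^ l)"
proof -
  have l: "l > 0" using assms by (simp add: prime_gt_0_nat)
  have "(a + b) ^ l = (\<Sum>k\<le>l. of_nat (l choose k) * a ^ k * b ^ (l - k))"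
    by (rule binomial_ring)
  also have "{..l} = insert 0 (insert l {0<..<l})" using l by auto
  also have "(\<Sum>k\<in>\<dots>. of_nat (l choose k) * a ^ k * b ^ (l - k)) =
      a ^ l + b ^ l + (\<Sum>k\<in>{0<..<l}. of_nat (l choose k) * a ^ k * b ^ (l - k))"
    using l by simp
  finally have "(a + b) ^ l - (a ^ l + b ^ l) =
      (\<Sum>k\<in>{0<..<l}. of_nat (l choose k) * a ^ k * b ^ (l - k))" by simp
  also have "of_nat l dvd \<dots>"
  proof (intro dvd_sum dvd_mult2)
    fix k assume "k \<in> {0<..<l}"
    then have "l dvd (l choose k)" using assms by (intro dvd_choose_prime) auto
    then show "(of_nat l :: 'a) dvd of_nat (l choose k)" by (auto elim!: dvdE)
  qed
  finally show ?thesis .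
qed

text \<open>Fermat's little theorem, by induction on naturals; negative \<open>a\<close> is replaced
  by its residue modulo \<open>l\<close>.\<close>

lemma prime_dvd_power_diff_int:
  assumes "prime l"
  shows "int l dvd a ^ l - a"
proof -
  have l: "l > 0" using assms by (simp add: prime_gt_0_nat)
  have nat: "int l dvd int n ^ l - int n" for n
  proof (induction n)
    case 0
    show ?case using l by (simp add: zero_power)
  next
    case (Suc n)
    have "int l dvd ((int n + 1) ^ l - (int n ^ l + 1 ^ l)) + (int n ^ l - int n)"
      using prime_dvd_add_power_diff[OF assms, of "int n" 1] Suc by (intro dvd_add) simp_all
    then show ?case by (simp add: algebra_simps)
  qed
  define b where "b = a mod int l"
  have "b = int (nat b)" using l by (simp add: b_def)
  then have "[b ^ l = b] (mod int l)" using nat[of "nat b"] by (simp add: cong_iff_dvd_diff)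
  moreover have "[a = b] (mod int l)" by (simp add: b_def cong_def)
  ultimately have "[a ^ l = a] (mod int l)"
    by (meson cong_pow cong_sym cong_trans)
  then show ?thesis by (simp add: cong_iff_dvd_diff)
qed

text \<open>Writing the polynomial as \<open>a + x p\<close>, the error splits into a multiple of
  the error for \<open>p\<close>, the Fermat error for \<open>a\<close>, and the error of the
  additive Frobenius identity.\<close>

lemma prime_dvd_pcompose_monom_diff_power:
  fixes p :: "int poly"
  assumes "prime l"
  shows "of_nat l dvd pcompose p (monom 1 l) - p ^ l"
proof (induction p)
  case 0
  show ?case using assms by (simp add: prime_gt_0_nat zero_power)
next
  case (pCons a p)
  let ?q = "[:0, 1:] * p"
  have *: "pCons a p = [:a:] + ?q" by simp
  have ql: "?q ^ l = monom 1 l * p ^ l"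
    by (subst power_mult_distrib) (simp add: monom_altdef)
  obtain k where k: "a ^ l - a = int l * k" using prime_dvd_power_diff_int[OF assms, of a] by (elim dvdE)
  have "[:a:] ^ l - [:a:] = [:a ^ l - a:]" by (simp add: poly_const_pow)
  also have "\<dots> = of_nat l * [:k:]" by (simp add: k of_nat_poly)
  finally have a: "of_nat l dvd [:a:] ^ l - [:a:]" by (rule dvdI)
  have "pcompose (pCons a p) (monom 1 l) - pCons a p ^ l =
      monom 1 l * (pcompose p (monom 1 l) - p ^ l) - ([:a:] ^ l - [:a:])
       - (([:a:] + ?q) ^ l - ([:a:] ^ l + ?q ^ l))"
    unfolding * by (simp only: ql) (simp add: pcompose_pCons algebra_simps)
  also have "of_nat l dvd \<dots>"
    by (intro dvd_diff dvd_mult pCons.IH a prime_dvd_add_power_diff assms)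
  finally show ?case .
qed

section \<open>Kronecker's theorem\<close>

text \<open>Lagrange interpolation: \<open>v\<close> is the combination of the basis polynomials
  \<open>L s\<close> with its values on \<open>S\<close> as weights. Hence \<open>C\<close> depends
  on \<open>S\<close> alone.\<close>

lemma lagrange_coeff_bound:
  fixes S :: "complex set"
  assumes "finite S"
  shows "\<exists>C>0. \<forall>v e k. degree v < card S \<longrightarrow> (\<forall>s\<in>S. norm (poly v s) \<le> e) \<longrightarrow> norm (coeff v k) \<le> e * C"
proof -
  define L where "L s = smult (1 / (\<Prod>t\<in>S-{s}. s - t)) (\<Prod>t\<in>S-{s}. [:-t, 1:])" for s
  define N where "N = card S"
  define C where "C = 1 + (\<Sum>k\<le>N. \<Sum>s\<in>S. norm (coeff (L s) k))"
  have L_self: "poly (L s) s = 1" if "s \<in> S" for s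
    using assms that by (simp add: L_def poly_prod)
  have L_other: "poly (L s) t = 0" if "t \<in> S" "t \<noteq> s" for s t
    using assms that by (auto simp: L_def poly_prod)
  have deg_L: "degree (L s) < card S" if "s \<in> S" for s
  proof -
    have "degree (L s) \<le> card (S - {s})"
      unfolding L_def by (intro order.trans[OF degree_smult_le] order.trans[OF degree_prod_sum_le])
        (use assms in auto)
    then show ?thesis using assms that by (meson card_Diff1_less le_less_trans)
  qed
  have "norm (coeff v k) \<le> e * C"
    if v: "degree v < card S" "\<And>s. s \<in> S \<Longrightarrow> norm (poly v s) \<le> e" for v e k
  proof -
    have "S \<noteq> {}" using v by auto
    then have e: "e \<ge> 0" using v(2) norm_ge_zero order.trans by blast
    have veq: "v = (\<Sum>s\<in>S. smult (poly v s) (L s))"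
    proof (rule poly_eqI_degree[where A = S])
      fix t assume t: "t \<in> S"
      have "poly (\<Sum>s\<in>S. smult (poly v s) (L s)) t = (\<Sum>s\<in>S. if s = t then poly v t else 0)"
        using t by (auto simp: poly_sum L_self L_other intro!: sum.cong)
      then show "poly v t = poly (\<Sum>s\<in>S. smult (poly v s) (L s)) t" using t assms by simp
    next
      show "card S > degree (\<Sum>s\<in>S. smult (poly v s) (L s))"
        by (intro degree_sum_less) (use v deg_L in \<open>auto intro: le_less_trans[OF degree_smult_le]\<close>)
    qed fact+
    show ?thesis
    proof (cases "k \<le> N")
      case True
      have "coeff v k = (\<Sum>s\<in>S. poly v s * coeff (L s) k)"
        by (subst veq) (simp add: coeff_sum)
      also have "norm \<dots> \<le> (\<Sum>s\<in>S. norm (poly v s * coeff (L s) k))" by (rule norm_sum)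
      also have "\<dots> \<le> (\<Sum>s\<in>S. e * norm (coeff (L s) k))"
        unfolding norm_mult by (intro sum_mono mult_right_mono v) auto
      also have "\<dots> = e * (\<Sum>s\<in>S. norm (coeff (L s) k))" by (simp add: sum_distrib_left)
      also have "(\<Sum>s\<in>S. norm (coeff (L s) k)) \<le> (\<Sum>k\<le>N. \<Sum>s\<in>S. norm (coeff (L s) k))"
        using True by (intro member_le_sum) (auto intro: sum_nonneg)
      then have "e * (\<Sum>s\<in>S. norm (coeff (L s) k)) \<le> e * C"
        using e by (intro mult_left_mono) (auto simp: C_def)
      finally show ?thesis .
    next
      case False
      then have "coeff v k = 0" using v by (intro coeff_eq_0) (auto simp: N_def)
      then show ?thesis using e by (auto simp: C_def intro!: mult_nonneg_nonneg add_nonneg_nonneg sum_nonneg)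
    qed
  qed
  moreover have "C > 0" unfolding C_def by (intro add_pos_nonneg sum_nonneg) auto
  ultimately show ?thesis by blast
qed

text \<open>From \<open>h(x^l) = h(x)^l + l u(x)\<close>, a zero \<open>s\<close> of
  \<open>h\<close> satisfies \<open>h(s^l) = l v(s)\<close>, where \<open>v\<close> is the remainder
  of \<open>u\<close> modulo \<open>h\<close>. The left side is bounded independently of
  \<open>l\<close>, so \<open>v\<close> must vanish once \<open>l\<close> is large. Simplicity of
  the zeros, expressed by \<open>card\<close>, makes interpolation on \<open>S\<close> applicable to
  \<open>v\<close>.\<close>

lemma large_prime_power_root:
  fixes h :: "int poly"
  defines "S \<equiv> {z :: complex. poly (ipoly h) z = 0}"
  assumes monic: "lead_coeff h = 1" and card: "card S = degree h"
    and le1: "\<And>z. z \<in> S \<Longrightarrow> norm z \<le> 1"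
  shows "\<exists>B. \<forall>l>B. prime l \<longrightarrow> (\<forall>s\<in>S. s ^ l \<in> S)"
proof -
  have h0: "h \<noteq> 0" using monic by auto
  have "(ipoly h :: complex poly) \<noteq> 0"
    using h0 by (metis degree_ipoly lead_coeff_ipoly monic leading_coeff_0_iff of_int_1 zero_neq_one)
  then have fin: "finite S" unfolding S_def by (rule poly_roots_finite)
  obtain C where C: "C > 0" "\<And>v e k. \<lbrakk>degree v < card S; \<forall>s\<in>S. norm (poly v s) \<le> e\<rbrakk> \<Longrightarrow> norm (coeff v k) \<le> e * C"
    using lagrange_coeff_bound[OF fin] by blast
  define M where "M = (\<Sum>i\<le>degree h. \<bar>real_of_int (coeff h i)\<bar>)"
  \<comment> \<open>This choice makes the coefficient bound \<open>M / l * C\<close> smaller than 1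
    for all \<open>l > B\<close>.\<close>
  obtain B :: nat where B: "real B > M * C" using reals_Archimedean2 by blast
  have "s ^ l \<in> S" if l: "l > B" "prime l" and s: "s \<in> S" for l s
  proof -
    have l0: "real l > 0" using l by simp
    obtain u where u: "pcompose h (monom 1 l) - h ^ l = of_nat l * u"
      using prime_dvd_pcompose_monom_diff_power[OF l(2), of h] by (elim dvdE)
    \<comment> \<open>As \<open>h\<close> is monic, pseudo-division is genuine division with
      remainder over the integers.\<close>
    obtain q v where qv: "pseudo_divmod u h = (q, v)" by fastforce
    have "u = h * q + v" using pseudo_divmod(1)[OF h0 qv] monic by simp
    have uv: "poly (ipoly u) t = (poly (ipoly v) t :: complex)" if "t \<in> S" for t
      using that unfolding \<open>u = h * q + v\<close> by (simp add: ipoly_add ipoly_mult S_def)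
    have val: "poly (ipoly h) (t ^ l) = of_nat l * (poly (ipoly v) t :: complex)" if t: "t \<in> S" for t
    proof -
      have "poly (ipoly (pcompose h (monom 1 l) - h ^ l)) t = (poly (ipoly (of_nat l * u)) t :: complex)"
        by (simp only: u)
      moreover have "ipoly (of_nat l) = (of_nat l :: complex poly)"
        by (simp add: of_nat_poly map_poly_pCons)
      ultimately show ?thesis using t l0 uv[OF t]
        by (simp add: ipoly_diff ipoly_mult ipoly_power poly_ipoly_pcompose_monom S_def zero_power)
    qed
    \<comment> \<open>The values of \<open>v\<close> on \<open>S\<close> are \<open>O(1/l)\<close>, hence so are its coefficients, which are integers.\<close>
    have "v = 0"
    proof (rule ccontr)
      assume "v \<noteq> 0"
      then have deg: "degree v < card S" using pseudo_divmod(2)[OF h0 qv] card by simp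
      have bnd: "norm (poly (ipoly v) t) \<le> M / real l" if t: "t \<in> S" for t :: complex
      proof -
        have "norm (t ^ l) \<le> 1" using le1[OF t] by (simp add: norm_power power_le_one)
        then have "norm (poly (ipoly h) (t ^ l)) \<le> M" unfolding M_def by (rule norm_poly_ipoly_le)
        then show ?thesis using l0 by (simp add: val[OF t] norm_mult field_simps)
      qed
      have "norm (coeff (ipoly v) k :: complex) \<le> M / real l * C" for k
        by (intro C(2)) (use deg bnd in \<open>auto simp: degree_ipoly\<close>)
      also have "M / real l * C < 1" using B l l0 by (simp add: field_simps)
      finally have "norm (coeff (ipoly v) (degree v) :: complex) < 1" .
      then have "\<bar>lead_coeff v\<bar> < 1" by (simp add: coeff_map_poly)
      then show False using \<open>v \<noteq> 0\<close> by simp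
    qed
    then have "poly (ipoly h) (s ^ l) = 0" using val[OF s] by simp
    then show ?thesis by (simp add: S_def)
  qed
  then show ?thesis by blast
qed

text \<open>\<open>S\<close> is closed under all large prime powers. Pigeonhole over these makes each element a root of
  unity, and every residue class prime to its order contains a number without small prime factors.\<close>
lemma cis_root_of_all_roots_on_circle:
  fixes h :: "int poly"
  defines "S \<equiv> {z :: complex. poly (ipoly h) z = 0}"
  assumes monic: "lead_coeff h = 1" and card: "card S = degree h"
    and circ: "\<And>z. z \<in> S \<Longrightarrow> norm z = 1" and deg: "degree h > 0"
  shows "\<exists>n>0. cis (2 * pi / real n) \<in> S"
proof -
  have "card S > 0" using card deg by simp
  then have fin: "finite S" and "S \<noteq> {}" by (auto simp: card_gt_0_iff)
  then obtain a where a: "a \<in> S" by auto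
  have a0: "a \<noteq> 0" using circ[OF a] by auto
  obtain B where B: "\<And>l s. \<lbrakk>l > B; prime l; s \<in> S\<rbrakk> \<Longrightarrow> s ^ l \<in> S"
  proof -
    have "\<exists>B. \<forall>l>B. prime l \<longrightarrow> (\<forall>s\<in>S. s ^ l \<in> S)"
      unfolding S_def by (rule large_prime_power_root) (use monic card circ in \<open>auto simp: S_def\<close>)
    then show thesis using that by blast
  qed
  \<comment> \<open>Closure extends from primes above \<open>B\<close> to products of such primes,
    peeling off one prime factor at a time.\<close>
  have B': "s ^ m \<in> S" if "m > 0" "\<And>q. \<lbrakk>prime q; q dvd m\<rbrakk> \<Longrightarrow> q > B" "s \<in> S" for m s
    using that
  proof (induction m arbitrary: s rule: less_induct)
    case (less m)
    show ?case
    proof (cases "m = 1")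
      case True
      then show ?thesis using less.prems by simp
    next
      case False
      then obtain q where q: "prime q" "q dvd m" using prime_factor_nat by blast
      then obtain m' where m': "m = q * m'" by (elim dvdE)
      have "m' < m" "m' > 0" using prime_gt_1_nat[OF q(1)] less.prems(1) m' by auto
      then have "(s ^ q) ^ m' \<in> S"
        using less.prems q B m' by (rule_tac less.IH) auto
      then show ?thesis by (simp add: m' power_mult)
    qed
  qed
  have "\<not> inj_on (\<lambda>l. a ^ l) {l. prime l \<and> l > B}"
  proof
    assume "inj_on (\<lambda>l. a ^ l) {l. prime l \<and> l > B}"
    moreover have "(\<lambda>l. a ^ l) ` {l. prime l \<and> l > B} \<subseteq> S" using a B by auto
    ultimately have "finite {l. prime l \<and> l > B}" using fin by (meson inj_on_finite)
    then have "finite ({l. prime l \<and> l > B} \<union> {..B})" by simp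
    then have "finite {l::nat. prime l}" by (rule rev_finite_subset) auto
    then show False using primes_infinite by simp
  qed
  then obtain k l where kl: "k < l" "a ^ k = a ^ l"
    unfolding inj_on_def by (metis nat_neq_iff)
  have "a ^ l = a ^ k * a ^ (l - k)" using kl(1) by (simp flip: power_add)
  then have "a ^ k * (a ^ (l - k) - 1) = 0" using kl(2) by (simp add: right_diff_distrib)
  then have ex: "a ^ (l - k) = 1" "l - k > 0" using a0 kl by auto
  define n where "n = (LEAST n. n > 0 \<and> a ^ n = 1)"
  have n: "n > 0" "a ^ n = 1" and least: "\<And>m. \<lbrakk>m > 0; a ^ m = 1\<rbrakk> \<Longrightarrow> n \<le> m"
    using LeastI[of "\<lambda>n. n > 0 \<and> a ^ n = 1" "l - k"] ex unfolding n_def by (auto intro: Least_le)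
  obtain k where k: "k < n" "a = cis (2 * pi * real k / real n)"
    using bij_betw_roots_unity[OF n(1)] n(2) unfolding bij_betw_def by blast
  have "coprime k n"
  proof (rule ccontr)
    assume "\<not> coprime k n"
    then obtain g where g: "g dvd k" "g dvd n" "g \<noteq> 1" unfolding coprime_def by auto
    then obtain k' n' where k': "k = g * k'" "n = g * n'" by (elim dvdE)
    have "g > 0" "n' > 0" using k' n by auto
    have "a ^ n' = cis (real n' * (2 * pi * real k / real n))" by (simp only: k(2) DeMoivre)
    also have "real n' * (2 * pi * real k / real n) = 2 * pi * real k'"
      using k' \<open>g > 0\<close> \<open>n' > 0\<close> by simp
    also have "cis (2 * pi * real k') = 1" by (rule cis_multiple_2pi) simp
    finally have "n \<le> n'" using least \<open>n' > 0\<close> by simp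
    then show False using k' g(3) \<open>g > 0\<close> \<open>n' > 0\<close> by simp
  qed
  \<comment> \<open>The inverse \<open>j\<close> of \<open>k\<close> modulo \<open>n\<close> is the
    exponent that carries \<open>a\<close> to \<open>cis (2 * pi / n)\<close>.\<close>
  then obtain j where j: "[k * j = 1] (mod n)" using cong_solve_coprime_nat[of k n] by auto
  have "coprime j n" using cong_imp_coprime[OF cong_sym[OF j]] by simp
  \<comment> \<open>\<open>j + n * T\<close> lies in the class of \<open>j\<close> modulo
    \<open>n\<close> and has no prime factor up to \<open>B\<close>: a prime dividing
    \<open>j\<close> divides neither \<open>n\<close> nor \<open>T\<close>, while a prime up to
    \<open>B\<close> not dividing \<open>j\<close> divides \<open>T\<close>.\<close>
  define T where "T = \<Prod>{q. prime q \<and> q \<le> B \<and> \<not> q dvd j}"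
  have finT: "finite {q. prime q \<and> q \<le> B \<and> \<not> q dvd j}" by (rule finite_subset[of _ "{..B}"]) auto
  have T0: "T > 0" unfolding T_def by (intro prod_pos) (auto simp: prime_gt_0_nat)
  have "a ^ (j + n * T) \<in> S"
  proof (rule B'[OF _ _ a])
    show "j + n * T > 0" using n T0 by simp
    fix q assume q: "prime q" "q dvd j + n * T"
    show "q > B"
    proof (rule ccontr)
      assume "\<not> q > B"
      show False
      proof (cases "q dvd j")
        case True
        then have "q dvd n * T" using q by (simp add: dvd_add_right_iff)
        moreover have "\<not> q dvd n" using True \<open>coprime j n\<close> q
          using coprime_common_divisor[of j n q] by auto
        ultimately have "q dvd T" using q by (simp add: prime_dvd_mult_iff)
        then obtain q' where "prime q'" "\<not> q' dvd j" "q dvd q'"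
          unfolding T_def using finT q(1) by (auto simp: prime_dvd_prod_iff)
        then have "q = q'" using q(1) by (intro primes_dvd_imp_eq)
        then show False using True \<open>\<not> q' dvd j\<close> by simp
      next
        case False
        then have "q dvd T" using q \<open>\<not> q > B\<close> finT unfolding T_def by (intro dvd_prodI) auto
        then show False using False q by (simp add: dvd_add_left_iff)
      qed
    qed
  qed
  also have "a ^ (j + n * T) = a ^ j" using n by (simp add: power_add power_mult)
  also have "a ^ j = cis (2 * pi / real n)"
  proof -
    obtain i1 i2 where i: "k * j + n * i1 = 1 + n * i2"
      using j by (metis cong_iff_lin_nat mult.commute)
    define w where "w = cis (2 * pi / real n)"
    have w: "w ^ n = 1" using n by (simp add: w_def DeMoivre)
    have "a ^ j = w ^ (k * j)" by (simp add: k(2) w_def DeMoivre mult_ac)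
    also have "\<dots> = w ^ (k * j + n * i1)" using w by (simp add: power_add power_mult)
    also have "\<dots> = w" using w by (simp add: i power_add power_mult)
    finally show ?thesis by (simp add: w_def)
  qed
  finally show ?thesis using n by blast
qed

section \<open>A criterion for Salem numbers\<close>

lemma clear_denominators: "\<exists>a>0. \<exists>F. smult (of_int a) (f :: rat poly) = ipoly F"
proof (induction f)
  case 0
  show ?case by (rule exI[of _ 1]) (auto intro: exI[of _ 0])
next
  case (pCons c f)
  then obtain a F where a: "a > 0" "smult (of_int a) f = ipoly F" by blast
  obtain p q where c: "c = of_int p / of_int q" "q > 0"
    by (metis quotient_of_div quotient_of_denom_pos surj_pair)
  have "smult (of_int (a * q)) (pCons c f) = ipoly (pCons (a * p) (smult q F))"
    using a(2) c by (simp add: map_poly_pCons map_poly_smult flip: a(2)) (simp add: mult.commute)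
  then show ?case using a(1) c(2) by (metis mult_pos_pos)
qed

lemma monic_rat_poly_primitive_multiple:
  assumes "lead_coeff (f :: rat poly) = 1"
  shows "\<exists>F. content F = 1 \<and> lead_coeff F > 0 \<and> smult (of_int (lead_coeff F)) f = ipoly F"
proof -
  obtain a F where a: "a > 0" "smult (of_int a) f = ipoly F" using clear_denominators by blast
  have lF: "lead_coeff F = a"
  proof -
    have "(of_int (lead_coeff F) :: rat) = lead_coeff (ipoly F)" by (simp only: lead_coeff_ipoly)
    also have "\<dots> = of_int a" using assms by (simp flip: a(2))
    finally show ?thesis by simp
  qed
  define c where "c = content F"
  define G where "G = primitive_part F"
  have F: "F = smult c G" by (simp add: c_def G_def)
  have "F \<noteq> 0" using lF a(1) by auto
  then have c: "c > 0" unfolding c_def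
    by (metis content_eq_zero_iff normalize_content normalize_int_def abs_ge_zero order_le_less abs_eq_0)
  have cG: "content G = 1" using \<open>F \<noteq> 0\<close> by (simp add: G_def)
  have la: "a = c * lead_coeff G" using lF c by (simp add: F)
  then have "lead_coeff G > 0" using a(1) c by (simp add: zero_less_mult_iff)
  moreover have "smult (of_int (lead_coeff G)) f = ipoly G"
  proof -
    have "smult (of_int c) (smult (of_int (lead_coeff G)) f) = smult (of_int c) (ipoly G)"
      using a(2) c by (simp add: F la map_poly_smult)
    then show ?thesis using c by (metis less_irrefl of_int_eq_0_iff smult_cancel)
  qed
  ultimately show ?thesis using cG by blast
qed

text \<open>The primitive multiples \<open>F\<close> and \<open>H\<close> have product
  \<open>a * b\<close> times \<open>P\<close>. Content is multiplicative, so \<open>a * b\<close>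
  divides 1; both being positive, the multipliers are 1 and the factors were already
  integral.\<close>

lemma gauss_lemma_monic:
  fixes f h :: "rat poly"
  assumes "f * h = ipoly P" "lead_coeff f = 1" "lead_coeff h = 1"
  shows "\<exists>F H. f = ipoly F \<and> h = ipoly H \<and> F * H = P \<and> lead_coeff F = 1 \<and> lead_coeff H = 1"
proof -
  obtain F where F: "content F = 1" "lead_coeff F > 0" "smult (of_int (lead_coeff F)) f = ipoly F"
    using monic_rat_poly_primitive_multiple[OF assms(2)] by blast
  obtain H where H: "content H = 1" "lead_coeff H > 0" "smult (of_int (lead_coeff H)) h = ipoly H"
    using monic_rat_poly_primitive_multiple[OF assms(3)] by blast
  define a where "a = lead_coeff F"
  define b where "b = lead_coeff H"
  have "ipoly (F * H) = (ipoly (smult (a * b) P) :: rat poly)"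
    by (simp add: ipoly_mult F(3)[symmetric] H(3)[symmetric] map_poly_smult assms(1)[symmetric] a_def b_def mult_ac)
  then have FH: "F * H = smult (a * b) P"
    unfolding poly_eq_iff coeff_map_poly[of of_int, OF of_int_0] of_int_eq_iff .
  then have "content F * content H = content (smult (a * b) P)" by (simp flip: content_mult)
  then have "1 = \<bar>a * b\<bar> * content P" using F H by (simp add: abs_mult)
  then have "a * b dvd 1" by (metis abs_dvd_iff dvd_triv_left)
  then have "a = 1" "b = 1" using F(2) H(2) unfolding a_def[symmetric] b_def[symmetric]
    by (auto simp: zdvd1_eq zmult_eq_1_iff)
  then show ?thesis using F(3) H(3) FH unfolding a_def b_def by (metis of_int_1 smult_1_left mult_1)
qed

section \<open>Vieta's formula and irreducibility\<close>

text \<open>Vieta's formula for the two top coefficients, over multisets to match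
  \<open>proots\<close>. The guard is there because \<open>size A - 1\<close> truncates at
  0.\<close>

lemma coeff_prod_mset_linear_factors:
  "coeff (\<Prod>x\<in>#A. [:- x, 1 :: 'a::comm_ring_1:]) (size A) = 1 \<and>
   (A \<noteq> {#} \<longrightarrow> coeff (\<Prod>x\<in>#A. [:- x, 1:]) (size A - 1) = - sum_mset A)"
proof (induction A)
  case (add x A)
  have [simp]: "coeff (\<Prod>x\<in>#A. [:- x, 1 :: 'a:]) (Suc (size A)) = 0"
  proof (rule coeff_eq_0)
    have "degree (\<Prod>x\<in>#A. [:- x, 1 :: 'a:]) \<le> size A"
    proof (induction A)
      case (add x A)
      have "degree ([:- x, 1:] * (\<Prod>x\<in>#A. [:- x, 1 :: 'a:])) \<le> degree [:- x, 1:] + degree (\<Prod>x\<in>#A. [:- x, 1 :: 'a:])"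
        by (rule degree_mult_le)
      also have "\<dots> \<le> 1 + size A" by (intro add_mono add) simp
      finally show ?case by simp
    qed simp
    then show "degree (\<Prod>x\<in>#A. [:- x, 1 :: 'a:]) < Suc (size A)" by simp
  qed
  show ?case using add by (cases "A = {#}") (auto simp: coeff_pCons split: nat.split)
qed simp

lemma sum_mset_proots_complex:
  fixes p :: "complex poly"
  assumes "lead_coeff p = 1" "degree p > 0"
  shows "sum_mset (proots p) = - coeff p (degree p - 1)"
proof -
  have "p = (\<Prod>x\<in>#proots p. [:-x, 1:])"
    using complex_poly_decompose_multiset[of p] assms by simp
  moreover have "size (proots p) = degree p" by (rule size_proots_complex)
  ultimately show ?thesis using coeff_prod_mset_linear_factors[of "proots p"] assms(2)
    by (metis add.inverse_inverse less_irrefl size_empty)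
qed

text \<open>A nonconstant monic integer factor without the zero \<open>t\<close> is impossible. If
  \<open>s\<close> is one of its zeros, its constant term is an integer of modulus \<open>s\<close>,
  strictly between 0 and 1; otherwise Kronecker's theorem yields a zero excluded by
  \<open>cis\<close>. Hence \<open>P\<close> is the minimal polynomial of \<open>t\<close>.\<close>

lemma salem_number_criterion:
  fixes P :: "int poly" and t s :: real
  defines "S \<equiv> {z :: complex. poly (ipoly P) z = 0}"
  assumes monic: "lead_coeff P = 1" and card: "card S = degree P" and deg: "degree P > 2"
    and t: "t > 1" "of_real t \<in> S" and s: "0 < s" "s < 1" "of_real s \<in> S"
    and circ: "\<And>z. \<lbrakk>z \<in> S; z \<noteq> of_real t; z \<noteq> of_real s\<rbrakk> \<Longrightarrow> norm z = 1"
    and cis: "\<And>n. n > 0 \<Longrightarrow> cis (2 * pi / real n) \<notin> S"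
  shows "salem_number t" "alg_trace (of_real t) = - of_int (coeff P (degree P - 1))"
proof -
  define rts where "rts F = {z :: complex. poly (ipoly F) z = 0}" for F :: "int poly"
  have S: "S = rts P" by (simp add: S_def rts_def)
  have rts_fin: "finite (rts F)" "card (rts F) \<le> degree F" if "F \<noteq> 0" for F
  proof -
    have "(ipoly F :: complex poly) \<noteq> 0"
      using that by (metis lead_coeff_ipoly leading_coeff_0_iff of_int_eq_0_iff)
    then show "finite (rts F)" "card (rts F) \<le> degree F"
      unfolding rts_def by (simp_all add: poly_roots_finite) (metis card_poly_roots_bound degree_ipoly)
  qed
  have cofactor: "degree H = 0"
    if P: "F * H = P" and lF: "lead_coeff F = 1" and lH: "lead_coeff H = 1" and tF: "of_real t \<in> rts F"
    for F H
  proof (rule ccontr)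
    assume dH: "degree H \<noteq> 0"
    have nz: "F \<noteq> 0" "H \<noteq> 0" using lF lH by auto
    have un: "S = rts F \<union> rts H" unfolding S rts_def P[symmetric] by (auto simp: ipoly_mult)
    have "degree P = degree F + degree H" using nz P degree_mult_eq by blast
    \<comment> \<open>Since \<open>P\<close> has only simple zeros, the count is tight:
      \<open>H\<close> has as many zeros as its degree, and none is shared with
      \<open>F\<close>.\<close>
    moreover have "card (rts F) + card (rts H) = card S + card (rts F \<inter> rts H)"
      unfolding un by (rule card_Un_Int) (use rts_fin nz in auto)
    ultimately have cH: "card (rts H) = degree H" and "card (rts F \<inter> rts H) = 0"
      using rts_fin(2)[OF nz(1)] rts_fin(2)[OF nz(2)] card by linarith+
    then have disj: "rts F \<inter> rts H = {}" using rts_fin nz by simp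
    then have tH: "of_real t \<notin> rts H" using tF by blast
    show False
    proof (cases "of_real s \<in> rts H")
      case True
      have "ipoly H = (\<Prod>z\<in>rts H. [:-z, 1:])"
      proof (rule poly_eqI_degree_lead_coeff[where A = "rts H" and n = "degree H"])
        show "coeff (ipoly H) (degree H) = coeff (\<Prod>z\<in>rts H. [:-z, 1:]) (degree H)"
          using lH coeff_prod_mset_linear_factors[of "mset_set (rts H)"] cH
          by (simp add: coeff_map_poly prod_unfold_prod_mset)
      next
        show "degree (\<Prod>z\<in>rts H. [:-z, 1:]) \<le> degree H"
          using cH rts_fin[OF nz(2)] by (simp add: degree_prod_sum_eq)
      qed (use cH rts_fin[OF nz(2)] in \<open>auto simp: degree_ipoly rts_def poly_prod\<close>)
      then have "poly (ipoly H) (of_int 0) = (\<Prod>z\<in>rts H. - z)" by (simp add: poly_prod)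
      then have "norm (of_int (poly H 0) :: complex) = (\<Prod>z\<in>rts H. norm z)"
        by (simp only: poly_ipoly_of_int) (simp add: prod_norm[symmetric])
      also have "\<dots> = (\<Prod>z\<in>{complex_of_real s}. norm z)"
      proof (intro prod.mono_neutral_right ballI)
        fix z assume "z \<in> rts H - {of_real s}"
        then show "norm z = 1" using tH un by (intro circ) auto
      qed (use rts_fin nz True in auto)
      also have "\<dots> = s" using s by simp
      finally have "real_of_int \<bar>poly H 0\<bar> = s" by simp
      then have "0 < real_of_int \<bar>poly H 0\<bar>" "real_of_int \<bar>poly H 0\<bar> < 1" using s by linarith+
      then show False by (simp only: of_int_0_less_iff of_int_less_1_iff)
    next
      case False
      have "\<exists>n>0. cis (2 * pi / real n) \<in> {z :: complex. poly (ipoly H) z = 0}"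
        by (rule cis_root_of_all_roots_on_circle)
          (use lH cH dH False tH un circ in \<open>auto simp: rts_def\<close>)
      then show False using cis un by (auto simp: rts_def)
    qed
  qed
  have of_rat_ipoly: "rat_to_complex_poly (ipoly F) = ipoly F" for F
    by (rule poly_eqI) (simp add: coeff_map_poly)
  have "irreducible (ipoly P :: rat poly)"
  proof (rule irreducibleI)
    show "(ipoly P :: rat poly) \<noteq> 0" using deg by (metis degree_0 degree_ipoly not_less_zero)
    show "\<not> is_unit (ipoly P :: rat poly)"
      using deg by (metis degree_ipoly is_unit_iff_degree dvd_0_left degree_0 not_less_zero one_neq_zero)
  next
    fix a b :: "rat poly" assume ab: "ipoly P = a * b"
    have lead: "lead_coeff a * lead_coeff b = 1"
      using lead_coeff_ipoly[of P, where ?'a = rat] monic unfolding ab by (simp add: lead_coeff_mult)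
    then have nz: "lead_coeff a \<noteq> 0" "a \<noteq> 0" "b \<noteq> 0" by auto
    \<comment> \<open>Both factors are rescaled to be monic; the product does not change because the
      leading coefficients multiply to 1.\<close>
    obtain F H where FH: "smult (inverse (lead_coeff a)) a = ipoly F" "smult (lead_coeff a) b = ipoly H"
      "F * H = P" "lead_coeff F = 1" "lead_coeff H = 1"
      using gauss_lemma_monic[of "smult (inverse (lead_coeff a)) a" "smult (lead_coeff a) b" P] lead nz ab
      by auto
    have dF: "degree F = degree a" "degree H = degree b"
      using arg_cong[OF FH(1), of degree] arg_cong[OF FH(2), of degree] nz by (simp_all add: degree_ipoly)
    have "of_real t \<in> rts F \<or> of_real t \<in> rts H"
      using t(2) unfolding S rts_def FH(3)[symmetric] by (auto simp: ipoly_mult)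
    then have "degree F = 0 \<or> degree H = 0"
      using cofactor[of F H] cofactor[of H F] FH by (auto simp: mult.commute)
    then show "is_unit a \<or> is_unit b" using nz by (auto simp: dF is_unit_iff_degree)
  qed
  then have min: "is_min_poly (of_real t) (ipoly P)"
    using monic t(2) unfolding is_min_poly_def of_rat_ipoly S_def by (simp add: lead_coeff_ipoly)
  have int: "algebraic_int t"
    unfolding algebraic_int_altdef_ipoly
  proof (intro exI conjI)
    have "complex_of_real (poly (ipoly P) t) = poly (ipoly P) (complex_of_real t)"
      by (induction P) (simp_all add: map_poly_pCons)
    then show "poly (ipoly P) t = 0" using t(2) unfolding S_def by (metis mem_Collect_eq of_real_eq_0_iff)
  qed fact
  then have "algebraic (complex_of_real t)" by (intro algebraic_int_imp_algebraic) auto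
  then have mp: "min_poly (of_real t) = ipoly P"
    using is_min_poly_min_poly is_min_poly_unique min by blast
  have conj: "conjugates (of_real t) = S"
    by (simp add: conjugates_def mp of_rat_ipoly S_def)
  \<comment> \<open>More than two distinct zeros force one on the unit circle, as the definition of
    a Salem number demands.\<close>
  have "\<not> S \<subseteq> {of_real t, of_real s}"
  proof
    assume "S \<subseteq> {of_real t, of_real s}"
    then have "card S \<le> card {complex_of_real t, of_real s}" by (intro card_mono) auto
    also have "\<dots> \<le> 2" by (simp add: card_insert_if)
    finally show False using deg card by simp
  qed
  then obtain z where z: "z \<in> S" "z \<noteq> of_real t" "z \<noteq> of_real s" by auto
  have "norm w \<le> 1" if "w \<in> S" "w \<noteq> of_real t" for w
    using circ[OF that] s by (cases "w = of_real s") auto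
  then show "salem_number t"
    unfolding salem_number_def conj using int t z circ[OF z] by blast
  have "sum_mset (proots (ipoly P :: complex poly)) = - coeff (ipoly P) (degree (ipoly P :: complex poly) - 1)"
    by (rule sum_mset_proots_complex) (use monic deg in \<open>auto simp: degree_ipoly coeff_map_poly\<close>)
  then show "alg_trace (of_real t) = - of_int (coeff P (degree P - 1))"
    by (simp add: alg_trace_def mp of_rat_ipoly degree_ipoly coeff_map_poly)
qed

section \<open>The polynomials\<close>

text \<open>The factorial makes every later exponent congruent to 1 modulo each positive integer up
  to twice an earlier one. This yields coprimality here and the cotangent estimate at roots of unity
  below.\<close>

fun exponent :: "nat \<Rightarrow> nat" where
  "exponent 0 = 2"
| "exponent (Suc k) = 1 + fact (2 * exponent k)"

lemma exponent_ge2: "exponent i \<ge> 2"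
  by (cases i) (simp_all add: fact_ge_1)

lemma exponent_less_Suc: "exponent i < exponent (Suc i)"
  using fact_ge_self[of "2 * exponent i"] exponent_ge2[of i] by simp

lemma exponent_mono: "i \<le> j \<Longrightarrow> exponent i \<le> exponent j"
  by (rule lift_Suc_mono_le[of exponent]) (use exponent_less_Suc less_imp_le in blast)+

lemma dvd_exponent_minus_1:
  assumes "0 < n" "n \<le> 2 * exponent j" "j < i"
  shows "n dvd exponent i - 1"
proof -
  obtain k where k: "i = Suc k" "j \<le> k" using assms(3) by (cases i) auto
  have "n dvd fact (2 * exponent k)"
    using assms(1,2) exponent_mono[OF k(2)] by (intro dvd_fact) auto
  then show ?thesis by (simp add: k)
qed

lemma coprime_exponent:
  assumes "i \<noteq> j"
  shows "coprime (exponent i) (exponent j)"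
proof -
  have *: "coprime (exponent j) (exponent i)" if "j < i" for i j
  proof -
    have "exponent j dvd exponent i - 1"
      using exponent_ge2[of j] that by (intro dvd_exponent_minus_1) auto
    then obtain k where "exponent i - 1 = exponent j * k" by (elim dvdE)
    then have i: "exponent i = exponent j * k + 1" using exponent_ge2[of i] by simp
    show ?thesis
    proof (rule coprimeI)
      fix d assume "d dvd exponent j" "d dvd exponent i"
      then show "is_unit d" unfolding i by (metis dvd_add_right_iff dvd_mult2)
    qed
  qed
  show ?thesis using assms *[of i j] *[of j i] by (cases "i < j") (auto simp: coprime_commute)
qed

text \<open>By Bezout. It separates the roots of unity belonging to different exponents, which share
  only 1.\<close>

lemma coprime_powers_eq_1:
  fixes z :: "'a::field"
  assumes "z ^ a = 1" "z ^ b = 1" "coprime a b"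
  shows "z = 1"
proof (cases "a = 0")
  case True
  then show ?thesis using assms by simp
next
  case False
  then obtain x y where xy: "a * x = b * y + 1"
    using bezout_nat[of a b] assms(3) by auto
  have "1 = z ^ (a * x)" using assms by (simp add: power_mult)
  also have "\<dots> = z" using assms by (simp add: xy power_mult)
  finally show ?thesis ..
qed

section \<open>Geometric polynomials and the construction\<close>

text \<open>The quotient \<open>(x^n - 1) / (x - 1)\<close>, whose zeros for \<open>n > 0\<close>
  are the \<open>n\<close>-th roots of unity other than 1.\<close>

definition geo_poly :: "nat \<Rightarrow> int poly" where
  "geo_poly n = (\<Sum>k<n. monom 1 k)"

lemma coeff_geo_poly: "coeff (geo_poly n) k = (if k < n then 1 else 0)"
  by (simp add: geo_poly_def coeff_sum)

lemma degree_geo_poly: "n > 0 \<Longrightarrow> degree (geo_poly n) = n - 1"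
  by (intro antisym degree_le le_degree) (auto simp: coeff_geo_poly)

lemma poly_geo_poly: "(x - 1) * poly (ipoly (geo_poly n)) x = (x :: 'a::comm_ring_1) ^ n - 1"
  by (simp add: geo_poly_def ipoly_sum map_poly_monom poly_sum poly_monom power_diff_1_eq)

lemma poly_geo_poly_1: "poly (geo_poly n) 1 = int n"
  by (simp add: geo_poly_def poly_sum poly_monom)

text \<open>Meant for reversed monic polynomials, where the linear coefficient is the original one
  just below the top.\<close>

lemma coeff_1_prod:
  fixes f :: "'b \<Rightarrow> 'a::comm_semiring_1 poly"
  assumes "\<And>i. i \<in> A \<Longrightarrow> coeff (f i) 0 = 1"
  shows "coeff (prod f A) 0 = 1 \<and> coeff (prod f A) 1 = (\<Sum>i\<in>A. coeff (f i) 1)"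
  using assms
  by (induction A rule: infinite_finite_induct) (auto simp: coeff_mult add.commute)

definition geo_prod :: "nat set \<Rightarrow> int poly" where
  "geo_prod A = (\<Prod>i\<in>A. geo_poly (exponent i))"

lemma monic_geo_prod: "lead_coeff (geo_prod A) = 1"
proof -
  have "lead_coeff (geo_poly (exponent i)) = 1" for i
    using exponent_ge2[of i] by (simp add: degree_geo_poly coeff_geo_poly)
  then show ?thesis by (simp add: geo_prod_def lead_coeff_prod)
qed

lemma degree_geo_prod: "degree (geo_prod A) = (\<Sum>i\<in>A. exponent i - 1)"
proof -
  have "geo_poly (exponent i) \<noteq> 0" for i
    using exponent_ge2[of i] coeff_geo_poly[of "exponent i" 0] by auto
  moreover have "degree (geo_poly (exponent i)) = exponent i - 1" for i
    using exponent_ge2[of i] by (simp add: degree_geo_poly)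
  ultimately show ?thesis by (simp add: geo_prod_def degree_prod_eq_sum_degree)
qed

lemma coeff_reflect_geo_prod:
  "coeff (reflect_poly (geo_prod A)) 1 = int (card A)"
proof -
  have "coeff (reflect_poly (geo_poly (exponent i))) 0 = 1"
       "coeff (reflect_poly (geo_poly (exponent i))) 1 = 1" for i
    using exponent_ge2[of i] by (simp_all add: coeff_reflect_poly degree_geo_poly coeff_geo_poly)
  then show ?thesis using coeff_1_prod[of A "\<lambda>i. reflect_poly (geo_poly (exponent i))"]
    by (simp add: geo_prod_def reflect_poly_prod)
qed

text \<open>The \<open>Q\<close> of the overview when \<open>r > 0\<close>. The zero 1 is absent
  from every geometric factor and put in once, so by coprimality all zeros are simple.\<close>

definition pole_poly :: "nat \<Rightarrow> int poly" where
  "pole_poly r = [:-1, 1:] * geo_prod {..<r}"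

text \<open>Divided by \<open>pole_poly r\<close> this is
  \<open>\<onehalf> (c A(z) + \<Sum>\<^sub>i A(z\<^sup>e\<^sup>i))\<close> with \<open>A(w) = (w + 1) / (w - 1)\<close>; here \<open>c + r\<close> must be even.\<close>
definition residue_poly :: "nat \<Rightarrow> nat \<Rightarrow> int poly" where
  "residue_poly c r = smult (int ((c + r) div 2)) (pole_poly r) + smult (int c) (geo_prod {..<r})
     + (\<Sum>i<r. geo_prod ({..<r} - {i}))"

text \<open>Since \<open>z Q (z - 1/z) = Q (z^2 - 1)\<close>, this is \<open>z Q\<close> times the
  bracket of the overview with denominators cleared.\<close>

definition salem_poly :: "nat \<Rightarrow> nat \<Rightarrow> int poly" where
  "salem_poly c r = pole_poly r * [:-1, 0, 1:] - [:0, 1:] * residue_poly c r"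

lemma monic_pole_poly: "lead_coeff (pole_poly r) = 1"
  unfolding pole_poly_def lead_coeff_mult monic_geo_prod by simp

lemma degree_pole_poly: "degree (pole_poly r) = 1 + (\<Sum>i<r. exponent i - 1)"
proof -
  have "geo_prod {..<r} \<noteq> 0" using monic_geo_prod[of "{..<r}"] by auto
  then show ?thesis by (simp add: pole_poly_def degree_mult_eq degree_geo_prod del: mult_pCons_left)
qed

text \<open>Read off after reversal: \<open>x - 1\<close> contributes \<open>-1\<close>, and each of
  the \<open>r\<close> geometric factors contributes 1.\<close>

lemma coeff_pole_poly: "coeff (pole_poly r) (degree (pole_poly r) - 1) = int r - 1"
proof -
  have "reflect_poly [:-1, 1 :: int:] = [:1, -1:]" by (simp add: reflect_poly_pCons)
  then have "coeff (reflect_poly (pole_poly r)) 1 = int r - 1"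
    using coeff_reflect_geo_prod[of "{..<r}"] monic_geo_prod[of "{..<r}"]
    by (simp add: pole_poly_def reflect_poly_mult coeff_pCons del: mult_pCons_left) simp
  then show ?thesis by (simp add: coeff_reflect_poly degree_pole_poly)
qed

text \<open>Every \<open>geo_prod\<close> term has smaller degree than \<open>pole_poly r\<close>,
  so only the first summand reaches the top.\<close>

lemma residue_poly_coeff:
  "degree (residue_poly c r) \<le> degree (pole_poly r)"
  "coeff (residue_poly c r) (degree (pole_poly r)) = int ((c + r) div 2)"
proof -
  have less: "degree (geo_prod A) < degree (pole_poly r)" if "A \<subseteq> {..<r}" for A
  proof -
    have "(\<Sum>i\<in>A. exponent i - 1) \<le> (\<Sum>i<r. exponent i - 1)"
      using that by (intro sum_mono2) auto
    then show ?thesis by (simp add: degree_geo_prod degree_pole_poly)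
  qed
  show "degree (residue_poly c r) \<le> degree (pole_poly r)"
    unfolding residue_poly_def
    by (intro degree_add_le degree_sum_le order.trans[OF degree_smult_le] less_imp_le[OF less]) auto
  have "coeff (geo_prod A) (degree (pole_poly r)) = 0" if "A \<subseteq> {..<r}" for A
    using less[OF that] by (rule coeff_eq_0)
  then show "coeff (residue_poly c r) (degree (pole_poly r)) = int ((c + r) div 2)"
    by (simp add: residue_poly_def coeff_sum monic_pole_poly)
qed

lemma salem_poly_coeffs:
  fixes c r :: nat
  defines "D \<equiv> degree (pole_poly r)"
  shows "degree (salem_poly c r) = D + 2" "lead_coeff (salem_poly c r) = 1"
    "coeff (salem_poly c r) (D + 1) = int r - 1 - int ((c + r) div 2)"
proof -
  have Q: "coeff (pole_poly r) k = 0" if "k > D" for k using that by (simp add: D_def coeff_eq_0)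
  have R: "coeff (residue_poly c r) k = 0" if "k > D" for k
    using that residue_poly_coeff(1)[of c r] by (intro coeff_eq_0) (simp add: D_def)
  have D: "D > 0" by (simp add: D_def degree_pole_poly)
  have coeff: "coeff (salem_poly c r) (Suc (Suc k)) =
      coeff (pole_poly r) k - coeff (pole_poly r) (Suc (Suc k)) - coeff (residue_poly c r) (Suc k)" for k
    by (simp add: salem_poly_def)
  have top: "coeff (salem_poly c r) (Suc (Suc D)) = 1"
    using Q[of "Suc (Suc D)"] R[of "Suc D"] by (simp add: coeff monic_pole_poly D_def)
  show deg: "degree (salem_poly c r) = D + 2"
  proof (rule antisym)
    show "degree (salem_poly c r) \<le> D + 2"
    proof (intro degree_le allI impI)
      fix k assume "k > D + 2"
      then obtain m where m: "k = Suc (Suc m)" "m > D" by (metis Suc_less_eq2 add_2_eq_Suc')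
      then show "coeff (salem_poly c r) k = 0"
        using Q[of m] Q[of "Suc (Suc m)"] R[of "Suc m"] by (simp add: coeff)
    qed
    show "D + 2 \<le> degree (salem_poly c r)" by (rule le_degree) (use top in simp)
  qed
  show "lead_coeff (salem_poly c r) = 1" using top by (simp add: deg)
  show "coeff (salem_poly c r) (D + 1) = int r - 1 - int ((c + r) div 2)"
    using coeff[of "D - 1"] D Q[of "Suc D"] coeff_pole_poly[of r] residue_poly_coeff(2)[of c r]
    by (simp add: D_def[symmetric])
qed

lemma poly_salem_poly_0: "poly (salem_poly c r) 0 = 1"
proof -
  have "poly (geo_poly (exponent i)) 0 = 1" for i
    using exponent_ge2[of i] by (simp add: poly_0_coeff_0 coeff_geo_poly)
  then show ?thesis by (simp add: salem_poly_def pole_poly_def geo_prod_def poly_prod)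
qed

text \<open>At 1 the polynomial \<open>pole_poly r\<close> vanishes and only minus a positive
  combination of values of \<open>geo_prod\<close> is left; \<open>c > 0\<close> makes it
  strict.\<close>

lemma poly_salem_poly_1:
  assumes "c > 0"
  shows "poly (salem_poly c r) 1 < 0"
proof -
  have *: "poly (geo_prod A) 1 > 0" for A
    unfolding geo_prod_def poly_prod using exponent_ge2
    by (intro prod_pos) (auto simp: poly_geo_poly_1 intro: less_le_trans[of 0 2])
  have Q: "poly (pole_poly r) 1 = 0" by (simp add: pole_poly_def)
  have "poly (residue_poly c r) 1 = int c * poly (geo_prod {..<r}) 1 + (\<Sum>i<r. poly (geo_prod ({..<r} - {i})) 1)"
    by (simp add: residue_poly_def poly_sum Q)
  also have "\<dots> > 0"
    using assms * by (intro add_pos_nonneg sum_nonneg mult_pos_pos) (auto intro: less_imp_le)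
  finally show ?thesis by (simp add: salem_poly_def Q)
qed

section \<open>Restriction to the unit circle\<close>

text \<open>The bracket of the overview at \<open>z = cis t\<close>, divided by
  \<open>\<i> / 2\<close>. It is real because \<open>A(cis u) = - \<i> cot (u / 2)\<close> and
  \<open>z - 1/z = 2 \<i> sin t\<close>.\<close>

definition phase :: "nat \<Rightarrow> nat \<Rightarrow> real \<Rightarrow> real" where
  "phase c r t = real c * cot (t / 2) + (\<Sum>i<r. cot (real (exponent i) * t / 2)) + 4 * sin t"

lemma cis_eq_1_iff_sin: "cis t = 1 \<longleftrightarrow> sin (t / 2) = 0"
proof -
  have "cos t = 1 - 2 * sin (t / 2) ^ 2" using cos_double_sin[of "t / 2"] by simp
  moreover have "sin t = 2 * sin (t / 2) * cos (t / 2)" using sin_double[of "t / 2"] by simp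
  ultimately show ?thesis by (auto simp: complex_eq_iff)
qed

lemma inverse_cis_minus_1:
  assumes "cis t \<noteq> 1"
  shows "1 / (cis t - 1) = - 1 / 2 - \<i> / 2 * of_real (cot (t / 2))"
proof -
  define s where "s = sin (t / 2)"
  define k where "k = cos (t / 2)"
  have s: "s \<noteq> 0" using assms by (simp add: cis_eq_1_iff_sin s_def)
  have sk: "s ^ 2 + k ^ 2 = 1" by (simp add: s_def k_def)
  have "cos t = 1 - 2 * s ^ 2" using cos_double_sin[of "t / 2"] by (simp add: s_def)
  moreover have "sin t = 2 * s * k" using sin_double[of "t / 2"] by (simp add: s_def k_def)
  ultimately have "cis t - 1 = 2 * of_real s * (- of_real s + \<i> * of_real k)"
    by (simp add: complex_eq_iff power2_eq_square)
  moreover have "2 * of_real s * (- of_real s + \<i> * of_real k) * (- 1 / 2 - \<i> / 2 * of_real (k / s)) = 1"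
    using s sk by (simp add: complex_eq_iff power2_eq_square field_simps)
  ultimately have "(cis t - 1) * (- 1 / 2 - \<i> / 2 * of_real (k / s)) = 1" by simp
  then show ?thesis using assms by (simp add: cot_def s_def k_def field_simps)
qed

text \<open>The reciprocals \<open>1 / (z - 1)\<close>, taken \<open>c\<close> times, and
  \<open>1 / (z^e - 1)\<close> each have real part \<open>-1/2\<close>; together these cancel
  \<open>(c + r) div 2\<close>, an exact half by evenness. Only cotangents remain.\<close>

lemma poly_salem_poly_cis:
  fixes t :: real
  defines "z \<equiv> cis t"
  assumes even: "even (c + r)" and z1: "z \<noteq> 1" and ze: "\<And>i. i < r \<Longrightarrow> z ^ exponent i \<noteq> 1"
  shows "poly (ipoly (salem_poly c r)) z = poly (ipoly (pole_poly r)) z * z * (\<i> / 2) * of_real (phase c r t)"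
proof -
  define Q where "Q = poly (ipoly (pole_poly r)) z"
  define G where "G A = poly (ipoly (geo_prod A)) z" for A
  have geo: "poly (ipoly (geo_poly (exponent i))) z = (z ^ exponent i - 1) / (z - 1)" for i
    using poly_geo_poly[of z "exponent i"] z1 by (simp add: field_simps)
  have Q: "Q = (z - 1) * G {..<r}"
    by (simp add: Q_def G_def pole_poly_def ipoly_mult map_poly_pCons del: mult_pCons_left)
  have G: "G ({..<r} - {i}) = Q * (1 / (z ^ exponent i - 1))" if "i < r" for i
  proof -
    have "G {..<r} = poly (ipoly (geo_poly (exponent i))) z * G ({..<r} - {i})"
      unfolding G_def geo_prod_def ipoly_prod poly_prod using that by (intro prod.remove) auto
    then show ?thesis using ze[OF that] z1 by (simp add: Q geo field_simps)
  qed
  have half: "of_nat ((c + r) div 2) = (of_nat c + of_nat r :: complex) / 2"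
  proof -
    obtain g where "c + r = 2 * g" using even by (elim evenE)
    then show ?thesis by (simp flip: of_nat_add)
  qed
  have "poly (ipoly (residue_poly c r)) z = of_nat ((c + r) div 2) * Q + of_nat c * G {..<r} + (\<Sum>i<r. G ({..<r} - {i}))"
    by (simp add: residue_poly_def ipoly_add map_poly_smult ipoly_sum poly_sum Q_def G_def)
  also have "(\<Sum>i<r. G ({..<r} - {i})) = Q * (\<Sum>i<r. 1 / (z ^ exponent i - 1))"
    unfolding sum_distrib_left by (intro sum.cong) (auto simp: G)
  also have "G {..<r} = Q * (1 / (z - 1))" using z1 by (simp add: Q)
  also have "of_nat ((c + r) div 2) * Q + of_nat c * (Q * (1 / (z - 1))) + Q * (\<Sum>i<r. 1 / (z ^ exponent i - 1))
     = Q * (of_nat ((c + r) div 2) + of_nat c * (1 / (z - 1)) + (\<Sum>i<r. 1 / (z ^ exponent i - 1)))"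
    by (simp only: algebra_simps)
  also have "(\<Sum>i<r. 1 / (z ^ exponent i - 1)) =
      (\<Sum>i<r. - 1 / 2 - \<i> / 2 * of_real (cot (real (exponent i) * t / 2)))"
  proof (intro sum.cong refl)
    fix i assume "i \<in> {..<r}"
    then have "cis (real (exponent i) * t) \<noteq> 1" using ze by (simp add: z_def DeMoivre)
    then show "1 / (z ^ exponent i - 1) = - 1 / 2 - \<i> / 2 * of_real (cot (real (exponent i) * t / 2))"
      using inverse_cis_minus_1[of "real (exponent i) * t"] by (simp add: z_def DeMoivre)
  qed
  also have "\<dots> = - of_nat r / 2 - \<i> / 2 * of_real (\<Sum>i<r. cot (real (exponent i) * t / 2))"
    by (simp add: sum_subtractf sum_distrib_left)
  also have "1 / (z - 1) = - 1 / 2 - \<i> / 2 * of_real (cot (t / 2))"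
    using z1 unfolding z_def by (rule inverse_cis_minus_1)
  finally have R: "poly (ipoly (residue_poly c r)) z =
      - Q * (\<i> / 2) * of_real (real c * cot (t / 2) + (\<Sum>i<r. cot (real (exponent i) * t / 2)))"
    by (simp add: half field_simps)
  have "z * cnj z = 1" by (simp add: z_def cis_cnj cis_mult)
  moreover have "z - cnj z = 2 * \<i> * of_real (sin t)" by (simp add: z_def complex_eq_iff)
  ultimately have sq: "z ^ 2 - 1 = z * (2 * \<i> * of_real (sin t))"
    by (metis power2_eq_square right_diff_distrib)
  have "poly (ipoly (salem_poly c r)) z = Q * (z ^ 2 - 1) - z * poly (ipoly (residue_poly c r)) z"
    by (simp add: salem_poly_def ipoly_diff ipoly_mult map_poly_pCons Q_def power2_eq_square
        del: mult_pCons_left mult_pCons_right)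
  also have "\<dots> = Q * z * (\<i> / 2) * of_real (phase c r t)"
    unfolding sq R phase_def by (simp add: algebra_simps)
  finally show ?thesis by (simp add: Q_def)
qed

section \<open>Zeros on the unit circle\<close>

lemma sin_add_eq_0:
  fixes x y :: real
  assumes "sin x = 0"
  shows "sin (x + y) = cos x * sin y" "cos (x + y) = cos x * cos y"
  using assms by (simp_all add: sin_add cos_add)

text \<open>The hypothesis says that \<open>x\<close> is an integral multiple of \<open>pi\<close>,
  so this is periodicity.\<close>

lemma cot_add_eq: "sin x = 0 \<Longrightarrow> cot (x + y) = cot (y :: real)"
  using sin_cos_squared_add[of x] by (auto simp: cot_def sin_add_eq_0)

lemma filterlim_cot_at_right_0: "filterlim (cot :: real \<Rightarrow> real) at_top (at_right 0)"
proof -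
  have "eventually (\<lambda>x::real. x \<in> {0<..<pi}) (at_right 0)"
    by (rule eventually_at_right_real) simp
  then have "eventually (\<lambda>x::real. sin x > 0) (at_right 0)"
    by eventually_elim (simp add: sin_gt_zero)
  moreover have "(sin \<longlongrightarrow> (0 :: real)) (at_right 0)"
    using tendsto_sin[OF tendsto_ident_at, of "0::real"] by simp
  ultimately have "filterlim (\<lambda>x::real. inverse (sin x)) at_top (at_right 0)"
    by (intro filterlim_inverse_at_top)
  moreover have "(cos \<longlongrightarrow> (1 :: real)) (at_right 0)"
    using tendsto_cos[OF tendsto_ident_at, of "0::real"] by simp
  ultimately have "filterlim (\<lambda>x::real. cos x * inverse (sin x)) at_top (at_right 0)"
    by (intro filterlim_tendsto_pos_mult_at_top[where c = 1]) auto
  then show ?thesis by (simp add: cot_def[abs_def] divide_inverse)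
qed

lemma cot_at_right_cases:
  fixes k t :: real
  assumes "k > 0"
  shows "sin (k * t / 2) = 0 \<Longrightarrow> filterlim (\<lambda>s. cot (k * s / 2)) at_top (at_right t)"
    and "sin (k * t / 2) \<noteq> 0 \<Longrightarrow> ((\<lambda>s. cot (k * s / 2)) \<longlongrightarrow> cot (k * t / 2)) (at_right t)"
proof -
  assume 0: "sin (k * t / 2) = 0"
  have lim: "filterlim (\<lambda>x. k * x / 2) (at_right 0) (at_right 0)"
    unfolding filterlim_at
  proof
    show "((\<lambda>x. k * x / 2) \<longlongrightarrow> 0) (at_right 0)" by (auto intro!: tendsto_eq_intros)
    have "eventually (\<lambda>x. x > 0) (at_right (0::real))" by (rule eventually_at_right_less)
    then show "eventually (\<lambda>x. k * x / 2 \<in> {0<..} \<and> k * x / 2 \<noteq> 0) (at_right 0)"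
      by eventually_elim (use assms in auto)
  qed
  have "cot (k * (s + t) / 2) = cot (k * s / 2)" for s
    using cot_add_eq[OF 0, of "k * s / 2"] by (simp add: algebra_simps add_divide_distrib)
  then show "filterlim (\<lambda>s. cot (k * s / 2)) at_top (at_right t)"
    by (subst filterlim_at_right_to_0) (simp add: filterlim_compose[OF filterlim_cot_at_right_0 lim])
next
  assume "sin (k * t / 2) \<noteq> 0"
  then show "((\<lambda>s. cot (k * s / 2)) \<longlongrightarrow> cot (k * t / 2)) (at_right t)"
    by (intro tendsto_intros) auto
qed

text \<open>All infinite limits have the same sign, so nothing cancels and a single divergent
  summand decides. This covers angles where several cotangents have a pole at once.\<close>

lemma filterlim_sum_at_top:
  fixes f :: "'b \<Rightarrow> 'a \<Rightarrow> real"
  assumes "finite A" "\<And>i. i \<in> A \<Longrightarrow> filterlim (f i) at_top F \<or> (\<exists>L. (f i \<longlongrightarrow> L) F)"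
    and ex: "\<exists>i\<in>A. filterlim (f i) at_top F"
  shows "filterlim (\<lambda>x. \<Sum>i\<in>A. f i x) at_top F"
proof -
  have *: "(\<exists>L. ((\<lambda>x. \<Sum>i\<in>A. f i x) \<longlongrightarrow> L) F) \<or> filterlim (\<lambda>x. \<Sum>i\<in>A. f i x) at_top F"
    if "finite A" "\<And>i. i \<in> A \<Longrightarrow> filterlim (f i) at_top F \<or> (\<exists>L. (f i \<longlongrightarrow> L) F)" for A
    using that
  proof (induction A rule: finite_induct)
    case empty
    then show ?case by auto
  next
    case (insert i A)
    let ?S = "\<lambda>x. \<Sum>i\<in>A. f i x"
    have S: "(\<exists>L. (?S \<longlongrightarrow> L) F) \<or> filterlim ?S at_top F"
      by (rule insert.IH) (use insert.prems in blast)
    have "filterlim (f i) at_top F \<or> (\<exists>L. (f i \<longlongrightarrow> L) F)" using insert.prems by blast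
    then have "(\<exists>L. ((\<lambda>x. f i x + ?S x) \<longlongrightarrow> L) F) \<or> filterlim (\<lambda>x. f i x + ?S x) at_top F"
    proof
      assume fi: "filterlim (f i) at_top F"
      have "filterlim (\<lambda>x. ?S x + f i x) at_top F"
        using S fi by (auto intro: filterlim_at_top_add_at_top filterlim_tendsto_add_at_top)
      then show ?thesis by (simp add: add.commute)
    next
      assume "\<exists>L. (f i \<longlongrightarrow> L) F"
      then obtain L where L: "(f i \<longlongrightarrow> L) F" by blast
      from S show ?thesis
      proof
        assume "\<exists>M. (?S \<longlongrightarrow> M) F"
        then show ?thesis using tendsto_add[OF L] by blast
      next
        assume "filterlim ?S at_top F"
        then show ?thesis using filterlim_tendsto_add_at_top[OF L] by blast
      qed
    qed
    then show ?case using insert.hyps by simp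
  qed
  obtain i where i: "i \<in> A" "filterlim (f i) at_top F" using ex by blast
  have "filterlim (\<lambda>x. (\<Sum>j\<in>A-{i}. f j x) + f i x) at_top F"
    using *[of "A - {i}"] assms(1,2) i
    by (auto intro: filterlim_at_top_add_at_top filterlim_tendsto_add_at_top)
  then show ?thesis using assms(1) i(1) by (simp add: sum.remove[of A i] add.commute)
qed

lemma phase_at_right:
  assumes c: "c > 0" and i: "i < r" "sin (real (exponent i) * t / 2) = 0"
  shows "filterlim (phase c r) at_top (at_right t)"
proof -
  define S where "S s = (\<Sum>i<r. cot (real (exponent i) * s / 2))" for s
  have e: "real (exponent i) > 0" for i using exponent_ge2[of i] by simp
  have S: "filterlim S at_top (at_right t)"
    unfolding S_def
    by (rule filterlim_sum_at_top)
      (use cot_at_right_cases[OF e] i in blast)+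
  have "filterlim (\<lambda>s. cot (s / 2)) at_top (at_right t) \<or> (\<exists>L. ((\<lambda>s. cot (s / 2)) \<longlongrightarrow> L) (at_right t))"
    using cot_at_right_cases[of 1 t] by (cases "sin (t / 2) = 0") auto
  then have "filterlim (\<lambda>s. real c * cot (s / 2) + S s) at_top (at_right t)"
  proof
    assume "filterlim (\<lambda>s. cot (s / 2)) at_top (at_right t)"
    then have "filterlim (\<lambda>s. real c * cot (s / 2)) at_top (at_right t)"
      using c by (intro filterlim_tendsto_pos_mult_at_top[OF tendsto_const]) auto
    then show ?thesis using S by (rule filterlim_at_top_add_at_top)
  next
    assume "\<exists>L. ((\<lambda>s. cot (s / 2)) \<longlongrightarrow> L) (at_right t)"
    then show ?thesis using S by (auto intro: filterlim_tendsto_add_at_top tendsto_mult_left)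
  qed
  moreover have "((\<lambda>s. 4 * sin s) \<longlongrightarrow> 4 * sin t) (at_right t)" by (intro tendsto_intros)
  ultimately have "filterlim (\<lambda>s. 4 * sin s + (real c * cot (s / 2) + S s)) at_top (at_right t)"
    by (rule filterlim_tendsto_add_at_top[rotated])
  then show ?thesis by (simp add: phase_def[abs_def] S_def add_ac)
qed

lemma phase_minus: "phase c r (- t) = - phase c r t"
  by (simp add: phase_def sum_negf)

text \<open>Oddness of \<open>phase\<close> turns the limit from the right at \<open>- t\<close>
  into the limit from the left at \<open>t\<close>.\<close>

lemma phase_at_left:
  assumes "c > 0" "i < r" "sin (real (exponent i) * t / 2) = 0"
  shows "filterlim (phase c r) at_bot (at_left t)"
proof -
  have "filterlim (phase c r) at_top (at_right (- t))"
    using assms by (intro phase_at_right[of c i]) auto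
  then show ?thesis
    by (simp add: filterlim_at_left_to_right phase_minus filterlim_uminus_at_bot)
qed

section \<open>Counting zeros between poles\<close>

text \<open>Between a pole and the next one, \<open>f\<close> falls from plus to minus infinity and
  crosses 0. The endpoint \<open>b\<close> closes the last gap, so each pole in \<open>T\<close>
  owns one zero.\<close>

lemma zeros_between_poles:
  fixes f :: "real \<Rightarrow> real" and T :: "real set"
  assumes fin: "finite T" and T: "T \<subseteq> {a..<b}"
    and right: "\<And>t. t \<in> T \<Longrightarrow> filterlim f at_top (at_right t)"
    and left: "\<And>t. t \<in> insert b T \<Longrightarrow> filterlim f at_bot (at_left t)"
    and cont: "\<And>t. \<lbrakk>a < t; t < b; t \<notin> T\<rbrakk> \<Longrightarrow> isCont f t"
  shows "\<exists>Z \<subseteq> {a<..<b} - T. card Z = card T \<and> (\<forall>z\<in>Z. f z = 0)"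
proof -
  define nxt where "nxt t = Min {s \<in> insert b T. t < s}" for t
  have nxt: "nxt t \<in> insert b T" "t < nxt t" and nxt_le: "\<And>s. \<lbrakk>s \<in> insert b T; t < s\<rbrakk> \<Longrightarrow> nxt t \<le> s"
    if "t \<in> T" for t
  proof -
    have fin': "finite {s \<in> insert b T. t < s}" using fin by simp
    moreover have "b \<in> {s \<in> insert b T. t < s}" using T that by auto
    ultimately have "nxt t \<in> {s \<in> insert b T. t < s}" unfolding nxt_def by (intro Min_in) auto
    then show "nxt t \<in> insert b T" "t < nxt t" by auto
    show "nxt t \<le> s" if "s \<in> insert b T" "t < s" for s
      unfolding nxt_def using fin' that by (intro Min_le) auto
  qed
  have "\<exists>z. t < z \<and> z < nxt t \<and> f z = 0" if t: "t \<in> T" for t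
  proof -
    \<comment> \<open>The midpoint keeps the sample point \<open>x\<close> near the left pole below
      the sample point \<open>y\<close> near the right one.\<close>
    define m where "m = (t + nxt t) / 2"
    have m: "t < m" "m < nxt t" using nxt(2)[OF t] by (auto simp: m_def)
    have "eventually (\<lambda>s. f s \<ge> 0) (at_right t)"
      using right[OF t] by (simp add: filterlim_at_top)
    moreover have "eventually (\<lambda>s. s \<in> {t<..<m}) (at_right t)"
      using m by (intro eventually_at_right_real)
    ultimately have "eventually (\<lambda>s. f s \<ge> 0 \<and> s \<in> {t<..<m}) (at_right t)" by eventually_elim auto
    then obtain x where x: "f x \<ge> 0" "t < x" "x < m"
      using eventually_happens trivial_limit_at_right_real by fastforce
    have "eventually (\<lambda>s. f s \<le> 0) (at_left (nxt t))"
      using left[OF nxt(1)[OF t]] by (simp add: filterlim_at_bot)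
    moreover have "eventually (\<lambda>s. s \<in> {m<..<nxt t}) (at_left (nxt t))"
      using m by (intro eventually_at_left_real)
    ultimately have "eventually (\<lambda>s. f s \<le> 0 \<and> s \<in> {m<..<nxt t}) (at_left (nxt t))" by eventually_elim auto
    then obtain y where y: "f y \<le> 0" "m < y" "y < nxt t"
      using eventually_happens trivial_limit_at_left_real by fastforce
    have "\<exists>z\<ge>x. z \<le> y \<and> f z = 0"
    proof (rule IVT2)
      show "\<forall>z. x \<le> z \<and> z \<le> y \<longrightarrow> isCont f z"
      proof (intro allI impI cont)
        fix z assume z: "x \<le> z \<and> z \<le> y"
        show "a < z" using z x t T by force
        show "z < b" using z y nxt_le[OF t, of b] t T by force
        show "z \<notin> T" using nxt_le[OF t, of z] z x y by force
      qed
    qed (use x y in auto)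
    then obtain z where "x \<le> z" "z \<le> y" "f z = 0" by blast
    then show ?thesis using x y by (intro exI[of _ z]) auto
  qed
  then obtain z where z: "\<And>t. t \<in> T \<Longrightarrow> t < z t \<and> z t < nxt t \<and> f (z t) = 0" by metis
  have less: "z t < z s" if "t \<in> T" "s \<in> T" "t < s" for t s
    using z[OF that(1)] z[OF that(2)] nxt_le[OF that(1), of s] that by force
  have "inj_on z T"
    by (rule inj_onI) (metis less less_irrefl linorder_neqE_linordered_idom)
  then have "card (z ` T) = card T" by (rule card_image)
  moreover have "z ` T \<subseteq> {a<..<b} - T"
  proof (intro image_subsetI DiffI)
    fix t assume t: "t \<in> T"
    show "z t \<in> {a<..<b}" using z[OF t] nxt_le[OF t, of b] t T by force
    show "z t \<notin> T" using z[OF t] nxt_le[OF t, of "z t"] by force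
  qed
  ultimately show ?thesis using z by (intro exI[of _ "z ` T"]) auto
qed

definition pole_angles :: "nat \<Rightarrow> real set" where
  "pole_angles r = {t \<in> {0..<2*pi}. \<exists>i<r. cis t ^ exponent i = 1}"

lemma inj_on_cis: "inj_on cis {0..<2*pi}"
proof (rule inj_onI)
  have *: "cis s \<noteq> cis t" if "0 \<le> s" "s < t" "t < 2 * pi" for s t
  proof
    assume "cis s = cis t"
    then have "cis (t - s) = 1" by (simp flip: cis_divide)
    moreover have "sin ((t - s) / 2) > 0" using that by (intro sin_gt_zero) auto
    ultimately show False by (simp add: cis_eq_1_iff_sin)
  qed
  fix s t assume "s \<in> {0..<2*pi}" "t \<in> {0..<2*pi}" "cis s = cis t"
  then show "s = t" using *[of s t] *[of t s] by (cases s t rule: linorder_cases) auto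
qed

text \<open>Different exponents share only the root 1. Counting it once and the other
  \<open>exponent i - 1\<close> roots for each \<open>i\<close> gives the degree;
  \<open>r > 0\<close> ensures that 1 occurs.\<close>

lemma card_pole_angles:
  assumes "r > 0"
  shows "finite (pole_angles r)" "card (pole_angles r) = degree (pole_poly r)"
proof -
  define U where "U i = {z :: complex. z ^ exponent i = 1}" for i
  have fin: "finite (U i)" and card: "card (U i) = exponent i" for i
    using exponent_ge2[of i] card_roots_unity_eq[of "exponent i"] finite_roots_unity[of "exponent i"]
    by (auto simp: U_def)
  have disj: "(U i - {1}) \<inter> (U j - {1}) = {}" if "i \<noteq> j" for i j
    using coprime_powers_eq_1[OF _ _ coprime_exponent[OF that]] by (auto simp: U_def)
  have "cis ` pole_angles r = (\<Union>i<r. U i)"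
  proof (intro equalityI subsetI)
    fix z assume "z \<in> cis ` pole_angles r"
    then show "z \<in> (\<Union>i<r. U i)" by (auto simp: pole_angles_def U_def)
  next
    fix z assume "z \<in> (\<Union>i<r. U i)"
    then obtain i where i: "i < r" "z ^ exponent i = 1" by (auto simp: U_def)
    have e: "exponent i > 0" using exponent_ge2[of i] by simp
    obtain k where k: "k < exponent i" "z = cis (2 * pi * real k / real (exponent i))"
      using bij_betw_roots_unity[OF e] i(2) unfolding bij_betw_def by blast
    have "2 * pi * real k / real (exponent i) \<in> pole_angles r"
      using i k e unfolding pole_angles_def by (auto simp: field_simps)
    then show "z \<in> cis ` pole_angles r" using k(2) by blast
  qed
  moreover have inj: "inj_on cis (pole_angles r)"
    using inj_on_cis by (rule inj_on_subset) (auto simp: pole_angles_def)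
  ultimately show "finite (pole_angles r)" using fin by (metis finite_UN_I finite_imageD finite_lessThan)
  have "card (pole_angles r) = card (\<Union>i<r. U i)"
    using card_image[OF inj] \<open>cis ` pole_angles r = (\<Union>i<r. U i)\<close> by simp
  also have "(\<Union>i<r. U i) = insert 1 (\<Union>i<r. U i - {1})" using assms by (auto simp: U_def)
  also have "card \<dots> = 1 + card (\<Union>i<r. U i - {1})" using fin by (subst card_insert_disjoint) auto
  also have "card (\<Union>i<r. U i - {1}) = (\<Sum>i<r. card (U i - {1}))"
    using fin disj by (intro card_UN_disjoint) auto
  also have "\<dots> = (\<Sum>i<r. exponent i - 1)"
    using fin card by (intro sum.cong) (auto simp: U_def card_Diff_singleton)
  finally show "card (pole_angles r) = degree (pole_poly r)" by (simp add: degree_pole_poly)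
qed

lemma cis_power_eq_1_iff: "cis t ^ n = 1 \<longleftrightarrow> sin (real n * t / 2) = 0"
  by (simp add: DeMoivre cis_eq_1_iff_sin)

lemma salem_poly_roots_on_circle:
  assumes c: "c > 0" and r: "r > 0" and even: "even (c + r)"
  shows "\<exists>Z :: complex set. card Z = degree (pole_poly r) \<and> (\<forall>z\<in>Z. norm z = 1 \<and> poly (ipoly (salem_poly c r)) z = 0)"
proof -
  have "\<exists>Z \<subseteq> {0<..<2*pi} - pole_angles r. card Z = card (pole_angles r) \<and> (\<forall>z\<in>Z. phase c r z = 0)"
  proof (rule zeros_between_poles)
    show "finite (pole_angles r)" using r by (rule card_pole_angles)
    show "pole_angles r \<subseteq> {0..<2*pi}" by (auto simp: pole_angles_def)
    show "filterlim (phase c r) at_top (at_right t)" if "t \<in> pole_angles r" for t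
      using that c by (auto simp: pole_angles_def cis_power_eq_1_iff intro: phase_at_right)
    \<comment> \<open>The angle \<open>2 * pi\<close> is outside \<open>pole_angles r\<close> but
      repeats the pole at 0, so the last gap also has a pole at its right end.\<close>
    show "filterlim (phase c r) at_bot (at_left t)" if "t \<in> insert (2*pi) (pole_angles r)" for t
      using that c r by (auto simp: pole_angles_def cis_power_eq_1_iff intro: phase_at_left)
    show "isCont (phase c r) t" if t: "0 < t" "t < 2 * pi" "t \<notin> pole_angles r" for t
    proof -
      have "sin (t / 2) \<noteq> 0" using t sin_gt_zero[of "t / 2"] by simp
      moreover have "sin (real (exponent i) * t / 2) \<noteq> 0" if "i < r" for i
        using t that by (auto simp: pole_angles_def cis_power_eq_1_iff)
      ultimately show ?thesis unfolding phase_def[abs_def] by (intro continuous_intros) auto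
    qed
  qed
  then obtain Z where Z: "Z \<subseteq> {0<..<2*pi} - pole_angles r" "card Z = card (pole_angles r)"
    "\<And>z. z \<in> Z \<Longrightarrow> phase c r z = 0" by blast
  have "inj_on cis Z" using inj_on_cis by (rule inj_on_subset) (use Z in auto)
  then have "card (cis ` Z) = degree (pole_poly r)"
    using card_pole_angles[OF r] Z(2) by (simp add: card_image)
  moreover have "poly (ipoly (salem_poly c r)) (cis t) = 0" if "t \<in> Z" for t
  proof (subst poly_salem_poly_cis[OF even])
    have t: "0 < t" "t < 2 * pi" "t \<notin> pole_angles r" using that Z(1) by auto
    show "cis t \<noteq> 1" using t sin_gt_zero[of "t / 2"] by (simp add: cis_eq_1_iff_sin)
    show "cis t ^ exponent i \<noteq> 1" if "i < r" for i using t that by (auto simp: pole_angles_def)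
  qed (use Z(3)[OF that] in simp)
  ultimately show ?thesis by (intro exI[of _ "cis ` Z"]) auto
qed

section \<open>Exclusion of roots of unity\<close>

lemma cot_nonneg: "0 < x \<Longrightarrow> x \<le> pi / 2 \<Longrightarrow> cot x \<ge> (0 :: real)"
  by (auto simp: cot_def intro!: divide_nonneg_nonneg cos_ge_zero sin_ge_zero)

text \<open>Let \<open>j\<close> be the least index with \<open>n < 2 e\<^sub>j\<close>. Earlier cotangents are nonnegative,
  later ones equal \<open>cot (\<pi>/n)\<close> because \<open>e\<^sub>i \<equiv> 1 (mod n)\<close>, and the one at \<open>j\<close> is at least
  \<open>- cot (\<pi>/n)\<close>, being the cotangent of an integral multiple of \<open>\<pi>/n\<close>.\<close>
lemma phase_root_of_unity_pos:
  assumes c: "c > 0" and n: "n \<ge> 3" and ndvd: "\<And>i. i < r \<Longrightarrow> \<not> n dvd exponent i"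
  shows "phase c r (2 * pi / real n) > 0"
proof -
  define x where "x = pi / real n"
  have x: "0 < x" "x < pi / 2" and nx: "real n * x = pi"
    using n divide_strict_left_mono[of 2 "real n" pi] by (simp_all add: x_def)
  have cx: "cot x > 0" using x by (rule cot_gt_zero)
  define w where "w i = cot (real (exponent i) * x)" for i
  have reduce: "w i = cot (real (exponent i mod n) * x)" for i
  proof -
    have "real (exponent i) = real (exponent i div n) * real n + real (exponent i mod n)"
      by (simp flip: of_nat_mult of_nat_add)
    then have "real (exponent i) * x = real (exponent i div n) * pi + real (exponent i mod n) * x"
      by (simp only: nx[symmetric] distrib_right mult.assoc)
    then show ?thesis by (simp add: w_def cot_add_eq)
  qed
  have w_small: "w i \<ge> 0" if "2 * exponent i \<le> n" for i
  proof -
    have "real (2 * exponent i) * x \<le> real n * x" using that x by (intro mult_right_mono) auto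
    then show ?thesis using nx x exponent_ge2[of i] unfolding w_def by (intro cot_nonneg) auto
  qed
  have w_ge: "w i \<ge> - cot x" if "i < r" for i
  proof -
    define q where "q = exponent i mod n"
    have q: "0 < q" "Suc q \<le> n" using ndvd[OF that] n by (auto simp: q_def dvd_eq_mod_eq_0 Suc_le_eq)
    have "real (Suc q) * x \<le> real n * x" using q x by (intro mult_right_mono) auto
    then have qx: "0 < real q * x" "real q * x + x \<le> pi" using nx x(1) q(1) by (simp_all add: distrib_right)
    have s: "sin (real q * x) > 0" "sin x > 0" using qx x by (auto intro!: sin_gt_zero)
    \<comment> \<open>With \<open>a = q x\<close> and \<open>q + 1 <= n\<close>, the angle
      \<open>a + x\<close> is at most \<open>pi\<close>, so the quotient is nonnegative.\<close>
    have "cot a + cot x = sin (a + x) / (sin a * sin x)" if "sin a > 0" for a :: real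
      using s(2) that by (simp add: cot_def sin_add add_frac_eq mult.commute add.commute)
    then have "cot (real q * x) + cot x = sin (real q * x + x) / (sin (real q * x) * sin x)"
      using s by blast
    also have "\<dots> \<ge> 0" using s qx x by (intro divide_nonneg_pos sin_ge_zero mult_pos_pos) auto
    finally show ?thesis by (simp add: reduce q_def)
  qed
  have sum_ge: "(\<Sum>i<r. w i) \<ge> - cot x"
  proof (cases "\<exists>j<r. n < 2 * exponent j")
    case False
    then have "(\<Sum>i<r. w i) \<ge> 0" by (intro sum_nonneg w_small) (metis lessThan_iff not_less)
    then show ?thesis using cx by simp
  next
    case True
    define j where "j = (LEAST j. n < 2 * exponent j)"
    obtain k where k: "k < r" "n < 2 * exponent k" using True by blast
    have j: "n < 2 * exponent j" unfolding j_def using k(2) by (rule LeastI)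
    have "j \<le> k" unfolding j_def using k(2) by (rule Least_le)
    then have jr: "j < r" using k(1) by simp
    have least: "2 * exponent i \<le> n" if "i < j" for i
      using not_less_Least[OF that[unfolded j_def]] by simp
    have "w i \<ge> 0" if "i \<noteq> j" for i
    proof (cases "i < j")
      case True
      then show ?thesis using least w_small by blast
    next
      case False
      then have "n dvd exponent i - 1" using that j n by (intro dvd_exponent_minus_1[of n j]) auto
      then obtain k where "exponent i - 1 = n * k" by (elim dvdE)
      then have "exponent i = n * k + 1" using exponent_ge2[of i] by simp
      then have "exponent i mod n = 1 mod n" by (metis mod_mult_self4 add.commute mult.commute)
      then have "exponent i mod n = 1" using n by simp
      then show ?thesis using cx by (simp add: reduce)
    qed
    then have "(\<Sum>i\<in>{..<r}-{j}. w i) \<ge> 0" by (intro sum_nonneg) auto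
    moreover have "(\<Sum>i<r. w i) = w j + (\<Sum>i\<in>{..<r}-{j}. w i)"
      using jr by (intro sum.remove) auto
    ultimately show ?thesis using w_ge[OF jr] by linarith
  qed
  \<comment> \<open>The term with factor \<open>c >= 1\<close> absorbs the possible deficit
    \<open>- cot x\<close> of the sum, and the sine makes the total strictly positive.\<close>
  have "real c * cot x \<ge> cot x" using c cx by simp
  moreover have "sin (2 * x) > 0" using x by (intro sin_gt_zero) auto
  moreover have "phase c r (2 * pi / real n) = real c * cot x + (\<Sum>i<r. w i) + 4 * sin (2 * x)"
    by (simp add: phase_def w_def x_def mult_ac)
  ultimately show ?thesis using sum_ge by linarith
qed

text \<open>Three cases: \<open>n = 1\<close> is settled by the negative value at 1, a divisor
  \<open>n\<close> of some exponent by a nonvanishing residue, and any other \<open>n\<close> by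
  positivity of \<open>phase\<close>.\<close>

lemma salem_poly_no_root_of_unity:
  assumes c: "c > 0" and r: "r > 0" and even: "even (c + r)" and n: "n > 0"
  shows "poly (ipoly (salem_poly c r)) (cis (2 * pi / real n)) \<noteq> 0"
proof -
  define z where "z = cis (2 * pi / real n)"
  have zn: "z ^ n = 1" using n by (simp add: z_def DeMoivre)
  have z_eq_1: "z ^ m = 1 \<longleftrightarrow> n dvd m" for m
  proof
    assume "z ^ m = 1"
    have "z ^ (m mod n) = 1"
    proof -
      have "z ^ m = z ^ (n * (m div n) + m mod n)" by simp
      also have "\<dots> = z ^ (m mod n)" by (simp only: power_add power_mult zn power_one mult_1)
      finally show ?thesis using \<open>z ^ m = 1\<close> by simp
    qed
    then have "cis (2 * pi * real (m mod n) / real n) = cis (2 * pi * real 0 / real n)"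
      by (simp add: z_def DeMoivre mult_ac)
    then have "m mod n = 0"
      using inj_onD[OF bij_betw_imp_inj_on[OF bij_betw_roots_unity[OF n]], of "m mod n" 0] n by simp
    then show "n dvd m" by auto
  next
    assume "n dvd m"
    then show "z ^ m = 1" by (auto simp: power_mult zn elim!: dvdE)
  qed
  show ?thesis
  proof (cases "n = 1")
    case True
    then have "poly (ipoly (salem_poly c r)) z = (of_int (poly (salem_poly c r) 1) :: complex)"
      using poly_ipoly_of_int[of "salem_poly c r" 1] by (simp add: z_def)
    then show ?thesis using poly_salem_poly_1[OF c, of r] by (simp add: z_def)
  next
    case False
    then have z1: "z \<noteq> 1" using z_eq_1[of 1] by simp
    show ?thesis
    proof (cases "\<exists>i<r. n dvd exponent i")
      case True
      then obtain i where i: "i < r" "n dvd exponent i" by blast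
      define G where "G A = poly (ipoly (geo_prod A)) z" for A
      have geo0: "poly (ipoly (geo_poly (exponent j))) z = 0 \<longleftrightarrow> j = i" for j
      proof -
        have "poly (ipoly (geo_poly (exponent j))) z = 0 \<longleftrightarrow> z ^ exponent j = 1"
          using poly_geo_poly[of z "exponent j"] z1 by auto
        also have "\<dots> \<longleftrightarrow> j = i"
          using coprime_powers_eq_1[OF _ _ coprime_exponent, of z j i] z1 i z_eq_1 by auto
        finally show ?thesis .
      qed
      have G0: "G A = 0 \<longleftrightarrow> i \<in> A" if "finite A" for A
        using that by (auto simp: G_def geo_prod_def ipoly_prod poly_prod geo0)
      have Q0: "poly (ipoly (pole_poly r)) z = 0"
        using G0[of "{..<r}"] i by (simp add: pole_poly_def ipoly_mult G_def del: mult_pCons_left)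
      have "poly (ipoly (residue_poly c r)) z = (\<Sum>j<r. G ({..<r} - {j}))"
        using G0[of "{..<r}"] i Q0
        by (simp add: residue_poly_def ipoly_add map_poly_smult ipoly_sum poly_sum G_def)
      \<comment> \<open>Only the summand that omits the factor vanishing at \<open>z\<close>
        survives; by coprimality that factor is unique.\<close>
      also have "\<dots> = (\<Sum>j\<in>{i}. G ({..<r} - {j}))"
        using G0 i by (intro sum.mono_neutral_right) auto
      also have "\<dots> \<noteq> 0" using G0[of "{..<r} - {i}"] by simp
      finally have R: "poly (ipoly (residue_poly c r)) z \<noteq> 0" .
      have "poly (ipoly (salem_poly c r)) z = - z * poly (ipoly (residue_poly c r)) z"
        by (simp add: salem_poly_def ipoly_diff ipoly_mult map_poly_pCons Q0
            del: mult_pCons_left mult_pCons_right)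
      then show ?thesis using R by (simp add: z_def)
    next
      case False
      \<comment> \<open>As \<open>r > 0\<close>, the exponent 2 is always present, so
        \<open>n = 2\<close> belongs to the previous case and \<open>n >= 3\<close> remains.\<close>
      then have "\<not> n dvd 2" using r by auto
      then have "n \<noteq> 2" by auto
      then have "n \<ge> 3" using \<open>n \<noteq> 1\<close> n by linarith
      have ze: "z ^ exponent i \<noteq> 1" if "i < r" for i using False that z_eq_1 by blast
      have G: "poly (ipoly (geo_poly (exponent i))) z \<noteq> 0" if "i < r" for i
        using poly_geo_poly[of z "exponent i"] ze[OF that] by auto
      have Q: "poly (ipoly (pole_poly r)) z \<noteq> 0"
        using G z1 by (auto simp: pole_poly_def ipoly_mult geo_prod_def ipoly_prod poly_prod map_poly_pCons
            simp del: mult_pCons_left)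
      have phase: "phase c r (2 * pi / real n) > 0"
        using c \<open>n \<ge> 3\<close> False by (intro phase_root_of_unity_pos) auto
      have eq: "poly (ipoly (salem_poly c r)) z =
          poly (ipoly (pole_poly r)) z * z * (\<i> / 2) * of_real (phase c r (2 * pi / real n))"
        using z1 ze unfolding z_def by (intro poly_salem_poly_cis even)
      have "z \<noteq> 0" by (simp add: z_def)
      then show ?thesis unfolding z_def[symmetric] eq using Q phase by simp
    qed
  qed
qed

section \<open>Salem numbers of prescribed trace\<close>

text \<open>The \<open>D\<close> zeros on the circle and the two real ones from sign changes already
  exhaust the degree \<open>D + 2\<close>. So all zeros are simple and known, and the criterion
  applies.\<close>

lemma salem_poly_is_salem:
  assumes c: "c > 0" and r: "r > 0" and even: "even (c + r)"
  shows "\<exists>t. salem_number t \<and> alg_trace (of_real t) = of_int (1 + (int c - int r) div 2)"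
proof -
  define P where "P = salem_poly c r"
  define D where "D = degree (pole_poly r)"
  define S where "S = {z :: complex. poly (ipoly P) z = 0}"
  have deg: "degree P = D + 2" and monic: "lead_coeff P = 1"
    unfolding P_def D_def by (rule salem_poly_coeffs)+
  have D: "D > 0" by (simp add: D_def degree_pole_poly)
  have real: "poly (ipoly P) (complex_of_real x) = of_real (poly (ipoly P) x)" for x
    by (induction P) (simp_all add: map_poly_pCons)
  have P0: "poly (ipoly P) 0 = (1 :: real)" and P1: "poly (ipoly P) 1 < (0 :: real)"
    using poly_ipoly_of_int[of P 0, where ?'a = real] poly_ipoly_of_int[of P 1, where ?'a = real]
      poly_salem_poly_0[of c r] poly_salem_poly_1[OF c, of r] by (simp_all add: P_def)
  obtain s where s: "0 < s" "s < 1" "poly (ipoly P) s = (0 :: real)"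
    using poly_IVT_neg[of 0 1 "ipoly P"] P0 P1 by auto
  have "lead_coeff (ipoly P :: real poly) = 1" using monic by (simp only: lead_coeff_ipoly of_int_1)
  then obtain b where b: "\<And>x. x \<ge> b \<Longrightarrow> poly (ipoly P) x \<ge> (1 :: real)"
    using poly_pinfty_gt_lc[of "ipoly P"] by auto
  \<comment> \<open>\<open>max b 2\<close> lies to the right of 1 and in the range where the
    polynomial is known to be positive.\<close>
  obtain t where t: "1 < t" "poly (ipoly P) t = (0 :: real)"
    using poly_IVT_pos[of 1 "max b 2" "ipoly P"] b[of "max b 2"] P1
    by (fastforce simp: less_max_iff_disj)
  obtain Z where Z: "card Z = D" "\<And>z. z \<in> Z \<Longrightarrow> norm z = 1 \<and> z \<in> S"
    using salem_poly_roots_on_circle[OF c r even] by (auto simp: D_def S_def P_def)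
  have finZ: "finite Z" using Z(1) D by (metis card_ge_0_finite)
  have notin: "of_real t \<notin> Z" "of_real s \<notin> insert (of_real t) Z"
    using Z(2)[of "of_real t"] Z(2)[of "of_real s"] s t by auto
  have sub: "insert (of_real s) (insert (of_real t) Z) \<subseteq> S"
    using Z s t by (auto simp: S_def real)
  have card: "card (insert (of_real s) (insert (of_real t) Z)) = degree P"
    using notin finZ by (simp add: deg Z(1))
  have nz: "(ipoly P :: complex poly) \<noteq> 0"
    using deg by (metis add_2_eq_Suc' degree_0 degree_ipoly nat.distinct(1))
  have finS: "finite S" unfolding S_def using nz by (rule poly_roots_finite)
  have "card S \<le> degree P" unfolding S_def using card_poly_roots_bound[OF nz] by (simp add: degree_ipoly)
  then have S: "S = insert (of_real s) (insert (of_real t) Z)"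
    using card_seteq[OF finS sub] card by simp
  have "salem_number t" "alg_trace (of_real t) = - of_int (coeff P (degree P - 1))"
    using salem_number_criterion[of P t s] monic card deg D t s S Z salem_poly_no_root_of_unity[OF c r even]
    unfolding S_def P_def[symmetric] by (auto simp: real)
  moreover have "coeff P (degree P - 1) = - (1 + (int c - int r) div 2)"
  proof -
    obtain g where g: "c + r = 2 * g" using even by (elim evenE)
    have "int c - int r = 2 * (int g - int r)" using arg_cong[OF g, of int] by simp
    then show ?thesis using salem_poly_coeffs(3)[of c r] g by (simp add: P_def[symmetric] D_def[symmetric] deg)
  qed
  ultimately show ?thesis by (intro exI[of _ t]) simp
qed

theorem mainTheorem2:
  shows "\<forall>m::int. \<exists>\<tau>::real. salem_number \<tau> \<and> alg_trace (of_real \<tau>) = of_int m"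
proof
  fix m :: int
  \<comment> \<open>Both \<open>c\<close> and \<open>r\<close> are odd and positive, so their sum is
    even. Since \<open>nat\<close> truncates negatives to 0, at least one of them is 1, and
    \<open>c - r = 2 * (m - 1)\<close> for either sign of \<open>m - 1\<close>.\<close>
  define c where "c = 1 + 2 * nat (m - 1)"
  define r where "r = 1 + 2 * nat (1 - m)"
  have "int c - int r = 2 * (m - 1)" by (simp add: c_def r_def)
  then have "1 + (int c - int r) div 2 = m" by simp
  then show "\<exists>\<tau>::real. salem_number \<tau> \<and> alg_trace (of_real \<tau>) = of_int m"
    using salem_poly_is_salem[of c r] by (simp add: c_def r_def)
qed

end
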